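(* Let $\varepsilon>0$. There exists $n_0=n_0(\varepsilon)$ such that the following holds for all integers $n,k$ with $n\ge n_0$ and $n>(2+\varepsilon)k^2$, and every positive integer $s<n$: if $\mathcal F_1,\dots,\mathcal F_s\subset\binom{[n]}{k}$ are non-trivial intersecting families and $\mathcal F=\bigcup_{i=1}^s\mathcal F_i$, then $$|\mathcal F|<\binom{n}{k}-\binom{n-s}{k}.$$
   Context: $[n]=\{1,\dots,n\}$ and $\binom{[n]}{k}$ is the set of $k$-element subsets of $[n]$. A family $\mathcal F$ is intersecting if $A\cap B\neq\emptyset$ for all $A,B\in\mathcal F$. The covering number $\tau(\mathcal F)$ is the smallest size of a set $X$ with $X\cap F\neq\emptyset$ for all $F\in\mathcal F$. A star (trivial family) is a family of the form $\mathcal S_x=\{F\in\binom{[n]}{k}:x\in F\}$ or a subfamily of one (covering number $1$); an intersecting family is non-trivial if $\tau(\mathcal F)\ge 2$. *)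

theory Defs
  imports Complex_Main
begin

definition uniform_subsets :: "nat \<Rightarrow> nat \<Rightarrow> nat set set" where
  "uniform_subsets n k = {A. A \<subseteq> {1..n} \<and> card A = k}"

text \<open>The case \<open>A = B\<close> is included, so the empty set is never a member of an intersecting family.\<close>

definition intersecting :: "'a set set \<Rightarrow> bool" where
  "intersecting F \<longleftrightarrow> (\<forall>A\<in>F. \<forall>B\<in>F. A \<inter> B \<noteq> {})"

definition is_cover :: "'a set \<Rightarrow> 'a set set \<Rightarrow> bool" where
  "is_cover X F \<longleftrightarrow> (\<forall>A\<in>F. X \<inter> A \<noteq> {})"

text \<open>The value is meaningful only if \<open>F\<close> has a finite cover; this holds for every
  intersecting family of finite sets, since each of its members is a cover. The empty family has
  covering number 0.\<close>

definition covering_number :: "'a set set \<Rightarrow> nat" where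
  "covering_number F = (LEAST m. \<exists>X. finite X \<and> card X = m \<and> is_cover X F)"

definition nontrivial_intersecting :: "'a set set \<Rightarrow> bool" where
  "nontrivial_intersecting F \<longleftrightarrow> intersecting F \<and> covering_number F \<ge> 2"

end

theory Submission
  imports Defs
begin

text \<open>Let \<open>N = M k\<close> for a large constant \<open>M\<close>. Spread approximation shows that a non-trivial
  intersecting family is controlled by a graph with at most \<open>k + O(1)\<close> edges: for all but a
  \<open>o(1/n)\<close> proportion of the \<open>N\<close>-sets \<open>S\<close>, every member of the family inside \<open>S\<close> contains an edge.
  Indeed, at most a small proportion of the \<open>N\<close>-sets contain a member without a spread core of size
  at most four, and since \<open>r\<close>-spread families with \<open>r\<close> of order \<open>sqrt k\<close> contain disjoint members, the
  cores form an intersecting family, which is generated by boundedly many of its covers.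
  If \<open>{x}\<close> is one of these covers, the edges join \<open>x\<close> to a member that avoids \<open>x\<close>; otherwise
  the covers of size two serve as edges and the larger ones are negligible.

  The union of the \<open>s\<close> graphs has average degree about \<open>2 s k / n\<close>. Inside almost every \<open>N\<close>-set the
  Moon--Moser inequality then bounds from below the number of edge-free \<open>k\<close>-sets, none of which
  lies in the union of the families. Averaging over the \<open>N\<close>-sets gives more than
  \<open>(n - s) choose k\<close> such sets as soon as \<open>n > (2 + \<epsilon>) k\<^sup>2\<close>.\<close>

subsection \<open>Spread families\<close>

text \<open>The indexing allows members with multiplicity.\<close>

definition spread :: "real \<Rightarrow> real \<Rightarrow> 'i set \<Rightarrow> ('i \<Rightarrow> 'a set) \<Rightarrow> bool" where
  "spread \<kappa> r I H \<longleftrightarrow>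
     (\<forall>Y. finite Y \<longrightarrow> real (card {i\<in>I. Y \<subseteq> H i}) * r ^ card Y \<le> \<kappa> * real (card I))"

section \<open>Minimal fragments and the recolouring count\<close>

text \<open>A minimum fragment in the sense of Park and Pham: the competition runs over all members
  inside \<open>W \<union> S i\<close>, so the fragment of \<open>i\<close> may come from another
  index \<open>j\<close>. Minimisers need not be unique, hence a predicate followed by a
  choice.\<close>

definition is_min_fragment :: "'a set \<Rightarrow> 'i set \<Rightarrow> ('i \<Rightarrow> 'a set) \<Rightarrow> 'i \<Rightarrow> 'a set \<Rightarrow> bool" where
  "is_min_fragment W J S i T \<longleftrightarrow>
     (\<exists>j\<in>J. S j \<subseteq> W \<union> S i \<and> T = S j - W) \<and>
     (\<forall>j\<in>J. S j \<subseteq> W \<union> S i \<longrightarrow> card T \<le> card (S j - W))"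

definition min_fragment :: "'a set \<Rightarrow> 'i set \<Rightarrow> ('i \<Rightarrow> 'a set) \<Rightarrow> 'i \<Rightarrow> 'a set" where
  "min_fragment W J S i = (SOME T. is_min_fragment W J S i T)"

lemma is_min_fragment_min_fragment:
  assumes "i \<in> J"
  shows "is_min_fragment W J S i (min_fragment W J S i)"
proof -
  let ?P = "\<lambda>j. j \<in> J \<and> S j \<subseteq> W \<union> S i"
  have "?P i" using assms by auto
  then obtain j where "?P j" "\<And>j'. ?P j' \<Longrightarrow> card (S j - W) \<le> card (S j' - W)"
    using exists_least_iff[of "\<lambda>m. \<exists>j. ?P j \<and> card (S j - W) = m"]
    by (metis (mono_tags, lifting) not_le_imp_less)
  then have "is_min_fragment W J S i (S j - W)"
    unfolding is_min_fragment_def by blast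
  then show ?thesis unfolding min_fragment_def by (rule someI)
qed

lemma min_fragment_subset:
  assumes "i \<in> J"
  shows "min_fragment W J S i \<subseteq> S i" "min_fragment W J S i \<inter> W = {}"
  using is_min_fragment_min_fragment[OF assms, of W S] unfolding is_min_fragment_def by auto

lemma min_fragment_source:
  assumes "i \<in> J"
  obtains j where "j \<in> J" "min_fragment W J S i = S j - W"
  using is_min_fragment_min_fragment[OF assms, of W S] unfolding is_min_fragment_def by auto

text \<open>Such an \<open>S j\<close> also competes for the fragment of \<open>i\<close>. Its part
  outside \<open>W\<close> lies in the fragment and cannot be smaller, so the two coincide.\<close>

lemma min_fragment_forced:
  assumes "i \<in> J" "j \<in> J" "S j \<subseteq> W \<union> min_fragment W J S i" "finite (S i)"
  shows "min_fragment W J S i \<subseteq> S j"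
proof -
  let ?T = "min_fragment W J S i"
  have T: "?T \<subseteq> S i" by (rule min_fragment_subset(1)[OF assms(1)])
  then have "card ?T \<le> card (S j - W)"
    using is_min_fragment_min_fragment[OF assms(1), of W S] assms(2,3)
    unfolding is_min_fragment_def by blast
  moreover have "S j - W \<subseteq> ?T" using assms(3) by auto
  moreover have "finite ?T" using T assms(4) finite_subset by auto
  ultimately have "S j - W = ?T" by (simp add: card_seteq)
  then show ?thesis by auto
qed

text \<open>A pair is recovered from its recoloured state, in which the fragment \<open>T\<close> has been added to
  the random set: by minimality, \<open>T\<close> is contained in every member of the family that lies inside
  the enlarged set, so there are few candidates for \<open>T\<close>.\<close>

lemma card_pairs_large_fragment:
  fixes \<Omega> :: "'w set" and G :: "'w \<Rightarrow> 'a set" and J :: "'w \<Rightarrow> 'i set"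
    and S :: "'w \<Rightarrow> 'i \<Rightarrow> 'a set" and c w t :: nat and r :: real
  assumes fin: "finite \<Omega>" "finite I" "finite V"
    and J: "\<And>\<omega>. \<omega> \<in> \<Omega> \<Longrightarrow> J \<omega> \<subseteq> I"
    and S: "\<And>\<omega> i. \<omega> \<in> \<Omega> \<Longrightarrow> i \<in> J \<omega> \<Longrightarrow> S \<omega> i \<subseteq> H i \<and> card (S \<omega> i) \<le> w"
    and H: "\<And>i. i \<in> I \<Longrightarrow> H i \<subseteq> V"
    and sp: "spread \<kappa> r I H" and r: "r > 0"
    and \<rho>: "\<And>\<omega> Y. \<omega> \<in> \<Omega> \<Longrightarrow> Y \<subseteq> V \<Longrightarrow> Y \<inter> G \<omega> = {} \<Longrightarrow>
            \<rho> \<omega> Y \<in> \<Omega> \<and> G (\<rho> \<omega> Y) = G \<omega> \<union> Y \<and> J (\<rho> \<omega> Y) = J \<omega> \<and> S (\<rho> \<omega> Y) = S \<omega>"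
    and fib: "\<And>\<omega>' Y. Y \<subseteq> V \<Longrightarrow> card {\<omega>\<in>\<Omega>. \<rho> \<omega> Y = \<omega>' \<and> Y \<inter> G \<omega> = {}} \<le> c ^ card Y"
  shows "real (card (SIGMA \<omega>:\<Omega>. {i\<in>J \<omega>. card (min_fragment (G \<omega>) (J \<omega>) (S \<omega>) i) = t}))
    \<le> real (card \<Omega>) * (real (w choose t) * (real c ^ t * (\<kappa> * real (card I) / r ^ t)))"
proof -
  let ?T = "\<lambda>\<omega> i. min_fragment (G \<omega>) (J \<omega>) (S \<omega>) i"
  let ?B = "SIGMA \<omega>:\<Omega>. {i\<in>J \<omega>. card (?T \<omega> i) = t}"
  \<comment> \<open>The candidates for the fragment, read off a recoloured state. The last clause
    supplies one member with at most \<open>w\<close> elements that contains them all, whence at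
    most \<open>w choose t\<close> candidates.\<close>
  define Q where "Q \<omega> = {Y. card Y = t \<and> Y \<subseteq> V \<and> (\<forall>j\<in>J \<omega>. S \<omega> j \<subseteq> G \<omega> \<longrightarrow> Y \<subseteq> S \<omega> j)
                         \<and> (\<exists>j\<in>J \<omega>. S \<omega> j \<subseteq> G \<omega>)}" for \<omega>
  \<comment> \<open>A superset of the pairs that reach the state \<open>\<omega>\<close> by adding
    \<open>Y\<close>: \<open>fib\<close> bounds the first factor by \<open>c ^ t\<close>, spreadness
    the second by \<open>\<kappa> * card I / r ^ t\<close>.\<close>
  define X where "X \<omega> Y = {\<omega>'\<in>\<Omega>. \<rho> \<omega>' Y = \<omega> \<and> Y \<inter> G \<omega>' = {}} \<times> {i\<in>I. Y \<subseteq> H i}" for \<omega> Y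
  have finQ: "finite (Q \<omega>)" for \<omega>
    by (rule finite_subset[of _ "Pow V"]) (use fin in \<open>auto simp: Q_def\<close>)
  have finX: "finite (X \<omega> Y)" for \<omega> Y using fin by (simp add: X_def)
  have cQ: "card (Q \<omega>) \<le> w choose t" if "\<omega> \<in> \<Omega>" for \<omega>
  proof (cases "\<exists>j\<in>J \<omega>. S \<omega> j \<subseteq> G \<omega>")
    case True
    then obtain j where j: "j \<in> J \<omega>" "S \<omega> j \<subseteq> G \<omega>" by auto
    have jI: "j \<in> I" using J[OF that] j(1) by auto
    have "S \<omega> j \<subseteq> V" using S[OF that j(1)] H[OF jI] by auto
    then have fS: "finite (S \<omega> j)" using fin(3) finite_subset by auto
    have "Q \<omega> \<subseteq> {Y. Y \<subseteq> S \<omega> j \<and> card Y = t}" using j by (auto simp: Q_def)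
    then have "card (Q \<omega>) \<le> card {Y. Y \<subseteq> S \<omega> j \<and> card Y = t}"
      using fS by (intro card_mono) auto
    also have "\<dots> = card (S \<omega> j) choose t" using fS n_subsets by blast
    also have "\<dots> \<le> w choose t" using S[OF that j(1)] by (simp add: binomial_right_mono)
    finally show ?thesis .
  next
    case False
    then have "Q \<omega> = {}" by (auto simp: Q_def)
    then show ?thesis by simp
  qed
  have cX: "real (card (X \<omega> Y)) \<le> real c ^ t * (\<kappa> * real (card I) / r ^ t)" if "Y \<in> Q \<omega>" for \<omega> Y
  proof -
    have Y: "card Y = t" "Y \<subseteq> V" "finite Y" using that fin finite_subset by (auto simp: Q_def)
    have "real (card {i\<in>I. Y \<subseteq> H i}) * r ^ t \<le> \<kappa> * real (card I)"
      using sp Y unfolding spread_def by blast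
    then have 1: "real (card {i\<in>I. Y \<subseteq> H i}) \<le> \<kappa> * real (card I) / r ^ t"
      using r by (simp add: field_simps)
    have "card {\<omega>'\<in>\<Omega>. \<rho> \<omega>' Y = \<omega> \<and> Y \<inter> G \<omega>' = {}} \<le> c ^ t" using fib[OF Y(2)] Y by auto
    then have 2: "real (card {\<omega>'\<in>\<Omega>. \<rho> \<omega>' Y = \<omega> \<and> Y \<inter> G \<omega>' = {}}) \<le> real c ^ t"
      by (metis of_nat_le_iff of_nat_power)
    show ?thesis unfolding X_def card_cartesian_product of_nat_mult
      by (rule mult_mono[OF 2 1]) auto
  qed
  have sub: "?B \<subseteq> (\<Union>\<omega>\<in>\<Omega>. \<Union>Y\<in>Q \<omega>. X \<omega> Y)"
  proof
    fix p assume "p \<in> ?B"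
    then obtain \<omega> i where p: "p = (\<omega>, i)" "\<omega> \<in> \<Omega>" "i \<in> J \<omega>" "card (?T \<omega> i) = t" by auto
    let ?Y = "?T \<omega> i"
    have iI: "i \<in> I" using J[OF p(2)] p(3) by auto
    note i = iI H[OF iI] S[OF p(2,3), THEN conjunct1]
    have Y: "?Y \<subseteq> S \<omega> i" "?Y \<inter> G \<omega> = {}" by (rule min_fragment_subset[OF p(3)])+
    then have YV: "?Y \<subseteq> V" using i by auto
    have "S \<omega> i \<subseteq> V" using i by auto
    then have fS: "finite (S \<omega> i)" using fin(3) finite_subset by auto
    let ?z = "\<rho> \<omega> ?Y"
    have z: "?z \<in> \<Omega>" "G ?z = G \<omega> \<union> ?Y" "J ?z = J \<omega>" "S ?z = S \<omega>" using \<rho>[OF p(2) YV Y(2)] by auto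
    obtain j where j: "j \<in> J \<omega>" "?Y = S \<omega> j - G \<omega>" by (rule min_fragment_source[OF p(3)])
    have "?Y \<subseteq> S \<omega> j'" if "j' \<in> J \<omega>" "S \<omega> j' \<subseteq> G \<omega> \<union> ?Y" for j'
      by (rule min_fragment_forced[OF p(3) that fS])
    then have "?Y \<in> Q ?z"
      unfolding Q_def z mem_Collect_eq using p(4) YV j by (intro conjI ballI impI bexI[of _ j]) auto
    moreover have "p \<in> X ?z ?Y" unfolding X_def p(1)
      using p(2) i(1) Y(2) order_trans[OF Y(1) i(3)] by simp
    ultimately show "p \<in> (\<Union>\<omega>\<in>\<Omega>. \<Union>Y\<in>Q \<omega>. X \<omega> Y)" using z(1) by (intro UN_I)
  qed
  let ?b = "real c ^ t * (\<kappa> * real (card I) / r ^ t)"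
  \<comment> \<open>The sign comes from spreadness at the empty set.\<close>
  have b0: "?b \<ge> 0"
    using sp[unfolded spread_def, rule_format, of "{}"] r by simp
  have "card ?B \<le> card (\<Union>\<omega>\<in>\<Omega>. \<Union>Y\<in>Q \<omega>. X \<omega> Y)"
    by (rule card_mono[OF _ sub]) (intro finite_UN_I fin finQ finX)
  also have "\<dots> \<le> (\<Sum>\<omega>\<in>\<Omega>. \<Sum>Y\<in>Q \<omega>. card (X \<omega> Y))"
    by (rule order_trans[OF card_UN_le[OF fin(1)]]) (intro sum_mono card_UN_le finQ)
  finally have "real (card ?B) \<le> real (\<Sum>\<omega>\<in>\<Omega>. \<Sum>Y\<in>Q \<omega>. card (X \<omega> Y))"
    by (rule of_nat_mono)
  also have "\<dots> = (\<Sum>\<omega>\<in>\<Omega>. \<Sum>Y\<in>Q \<omega>. real (card (X \<omega> Y)))" by simp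
  also have "\<dots> \<le> (\<Sum>\<omega>\<in>\<Omega>. real (w choose t) * ?b)"
  proof (rule sum_mono)
    fix \<omega> assume w: "\<omega> \<in> \<Omega>"
    have "(\<Sum>Y\<in>Q \<omega>. real (card (X \<omega> Y))) \<le> (\<Sum>Y\<in>Q \<omega>. ?b)" by (intro sum_mono cX)
    also have "\<dots> = real (card (Q \<omega>)) * ?b" by simp
    also have "\<dots> \<le> real (w choose t) * ?b" using cQ[OF w] b0 by (intro mult_right_mono) auto
    finally show "(\<Sum>Y\<in>Q \<omega>. real (card (X \<omega> Y))) \<le> real (w choose t) * ?b" .
  qed
  also have "\<dots> = real (card \<Omega>) * (real (w choose t) * ?b)" by (rule sum_constant)
  finally show ?thesis by this
qed

section \<open>Numerical estimates for binomial coefficients\<close>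

text \<open>A weak form of Stirling's formula; the induction step is
  \<open>(1 + 1 / t) ^ t <= e <= 3\<close>.\<close>

lemma self_power_le_fact: "real t ^ t \<le> 3 ^ t * fact t"
proof (induction t)
  case (Suc t)
  show ?case
  proof (cases "t = 0")
    case False
    have "(1 + 1 / real t) ^ t \<le> exp 1"
      using exp_ge_one_plus_x_over_n_power_n[of t 1] False by simp
    also have "\<dots> \<le> 3" by (rule exp_le)
    finally have *: "(1 + 1 / real t) ^ t \<le> 3" .
    have "real (Suc t) = real t * (1 + 1 / real t)" using False by (simp add: field_simps)
    then have "real (Suc t) ^ t = real t ^ t * (1 + 1 / real t) ^ t"
      by (simp only: power_mult_distrib)
    also have "\<dots> \<le> (3 ^ t * fact t) * 3" using Suc * by (intro mult_mono) auto
    finally have "real (Suc t) * real (Suc t) ^ t \<le> real (Suc t) * ((3 ^ t * fact t) * 3)"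
      by (intro mult_left_mono) auto
    then show ?thesis by (simp only: power_Suc fact_Suc of_nat_mult mult_ac)
  qed simp
qed simp

lemma binomial_le_power: "real (n choose t) \<le> real n ^ t"
proof -
  have "(n choose t) * fact t \<le> n ^ t" by (rule binomial_fact_pow)
  moreover have "(n choose t) * 1 \<le> (n choose t) * fact t" by (intro mult_left_mono) auto
  ultimately have "(n choose t) \<le> n ^ t" by linarith
  then show ?thesis by (metis of_nat_le_iff of_nat_power)
qed

text \<open>From \<open>k choose t <= k ^ t / t!\<close> and \<open>t! >= (t / 3) ^ t\<close> the
  product is at most \<open>(3 * k * x / t) ^ t\<close>; the constant is
  \<open>48 = 3 * 16\<close>.\<close>

lemma binomial_times_power_le:
  assumes "t > 0" "x \<ge> 0" "48 * real k * x \<le> real t"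
  shows "real (k choose t) * x ^ t \<le> (1 / 16) ^ t"
proof -
  have "real ((k choose t) * fact t) \<le> real (k ^ t)"
    by (intro of_nat_mono binomial_fact_pow)
  then have 1: "real (k choose t) * fact t \<le> real k ^ t" by simp
  have "real (k choose t) * x ^ t * real t ^ t \<le> real (k choose t) * x ^ t * (3 ^ t * fact t)"
    using assms by (intro mult_left_mono self_power_le_fact) auto
  also have "\<dots> = (3 * x) ^ t * (real (k choose t) * fact t)"
    by (simp add: power_mult_distrib)
  also have "\<dots> \<le> (3 * x) ^ t * real k ^ t" using assms 1 by (intro mult_left_mono) auto
  also have "\<dots> = (3 * real k * x) ^ t" by (simp add: power_mult_distrib)
  also have "\<dots> \<le> (real t / 16) ^ t" using assms by (intro power_mono) auto
  also have "\<dots> = (1 / 16) ^ t * real t ^ t" by (simp add: power_divide)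
  finally show ?thesis using assms(1) by simp
qed

lemma sum_power_16_le: "finite A \<Longrightarrow> 0 \<notin> A \<Longrightarrow> (\<Sum>t\<in>A. (1 / 16 :: real) ^ t) \<le> 1 / 15"
proof -
  assume A: "finite A" "0 \<notin> A"
  have s: "(\<lambda>t. (1 / 16 :: real) ^ t) sums (1 / (1 - 1 / 16))" by (intro geometric_sums) auto
  have "(\<Sum>t\<in>insert 0 A. (1 / 16 :: real) ^ t) \<le> (\<Sum>t. (1 / 16) ^ t)"
    using s A by (intro sum_le_suminf) (auto simp: sums_iff)
  also have "\<dots> = 16 / 15" using s by (simp add: sums_iff)
  finally show ?thesis using A by simp
qed

section \<open>Two rounds of exposure and disjoint members\<close>

text \<open>A preimage is determined by the traces of its two components on
  \<open>Y\<close>.\<close>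

lemma card_pairs_Un_eq:
  assumes "finite V" "Y \<subseteq> V"
  shows "card {\<omega> \<in> Pow V \<times> Pow V. (fst \<omega> \<union> Y, snd \<omega> \<union> Y) = \<omega>'} \<le> 4 ^ card Y" (is "card ?A \<le> _")
proof -
  have fY: "finite Y" using assms finite_subset by auto
  have "card ?A \<le> card (Pow Y \<times> Pow Y)"
  proof (rule card_inj_on_le)
    have "A = B" if "A \<union> Y = B \<union> Y" "A \<inter> Y = B \<inter> Y" for A B :: "'a set" using that by blast
    then show "inj_on (\<lambda>\<omega>. (fst \<omega> \<inter> Y, snd \<omega> \<inter> Y)) ?A"
      by (intro inj_onI) (auto simp: prod_eq_iff)
  qed (use fY in auto)
  then show ?thesis using fY by (simp add: card_cartesian_product card_Pow flip: power_mult_distrib)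
qed

text \<open>The first component is disjoint from \<open>Y\<close> and therefore recovered exactly;
  only the trace of the second one on \<open>Y\<close> is lost.\<close>

lemma card_pairs_Un_Diff_eq:
  assumes "finite V" "Y \<subseteq> V"
  shows "card {\<omega> \<in> Pow V \<times> Pow V. (fst \<omega> \<union> Y, snd \<omega> - Y) = \<omega>' \<and> Y \<inter> fst \<omega> = {}} \<le> 2 ^ card Y"
    (is "card ?A \<le> _")
proof -
  have fY: "finite Y" using assms finite_subset by auto
  have "card ?A \<le> card (Pow Y)"
  proof (rule card_inj_on_le)
    show "inj_on (\<lambda>\<omega>. snd \<omega> \<inter> Y) ?A"
    proof (rule inj_onI)
      fix x y assume "x \<in> ?A" "y \<in> ?A" and e: "snd x \<inter> Y = snd y \<inter> Y"
      then have x: "fst x \<union> Y = fst \<omega>'" "snd x - Y = snd \<omega>'" "Y \<inter> fst x = {}"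
        and y: "fst y \<union> Y = fst \<omega>'" "snd y - Y = snd \<omega>'" "Y \<inter> fst y = {}"
        by (metis (mono_tags, lifting) fst_conv snd_conv mem_Collect_eq)+
      have "fst x = fst \<omega>' - Y" "fst y = fst \<omega>' - Y" using x y by blast+
      moreover have "snd x = snd \<omega>' \<union> (snd x \<inter> Y)" "snd y = snd \<omega>' \<union> (snd y \<inter> Y)"
        using x(2) y(2) by blast+
      ultimately show "x = y" using e by (simp add: prod_eq_iff)
    qed
  qed (use fY in auto)
  then show ?thesis using fY by (simp add: card_Pow)
qed

text \<open>Two rounds of random exposure, by \<open>W \<inter> U\<close> and then by \<open>W\<close>, for a random pair \<open>(W, U)\<close>. The first
  typically leaves fragments of size \<open>O(k / r)\<close>, the second typically leaves none. The second
  recolouring \<open>(W \<union> Y, U - Y)\<close> does not change \<open>W \<inter> U\<close>, hence preserves the fragments of the first.\<close>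

lemma spread_covers_majority:
  fixes H :: "'i \<Rightarrow> 'a set" and r :: real
  assumes fin: "finite V" "finite I" and I: "I \<noteq> {}"
    and H: "\<And>i. i \<in> I \<Longrightarrow> H i \<subseteq> V \<and> card (H i) \<le> k"
    and sp: "spread 2 r I H" and r: "r > 0" "r\<^sup>2 \<ge> 6144 * real k"
  shows "2 * card {W \<in> Pow V. \<exists>i\<in>I. H i \<subseteq> W} > 2 ^ card V"
proof -
  define \<Omega> where "\<Omega> = Pow V \<times> Pow V"
  \<comment> \<open>Since \<open>192 = 48 * 4\<close>, sizes \<open>t > w\<close> satisfy the
    condition of \<open>binomial_times_power_le\<close> with \<open>x = 4 / r\<close>.\<close>
  define w where "w = nat \<lfloor>192 * real k / r\<rfloor>"
  define T1 where "T1 W = min_fragment W I H" for W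
  define J where "J W = {i\<in>I. card (T1 W i) \<le> w}" for W
  define T2 where "T2 \<omega> = min_fragment (fst \<omega>) (J (fst \<omega> \<inter> snd \<omega>)) (T1 (fst \<omega> \<inter> snd \<omega>))" for \<omega>
  have fin\<Omega>: "finite \<Omega>" using fin by (simp add: \<Omega>_def)
  have card\<Omega>: "card \<Omega> = 2 ^ card V * 2 ^ card V" by (simp add: \<Omega>_def card_cartesian_product card_Pow fin)
  let ?N = "real (card \<Omega>) * real (card I)"
  have N0: "?N > 0" using card\<Omega> fin I by (simp add: card_gt_0_iff)
  have fH: "finite (H i)" if "i \<in> I" for i using H[OF that] fin finite_subset by auto
  have T1: "T1 W i \<subseteq> H i" if "i \<in> I" for W i unfolding T1_def by (rule min_fragment_subset[OF that])

  define B1 where "B1 t = (SIGMA \<omega>:\<Omega>. {i\<in>I. card (T1 (fst \<omega> \<inter> snd \<omega>) i) = t})" for t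
  define B2 where "B2 t = (SIGMA \<omega>:\<Omega>. {i\<in>J (fst \<omega> \<inter> snd \<omega>). card (T2 \<omega> i) = t})" for t
  \<comment> \<open>Adding the fragment to both components puts it into their intersection; each of
    its elements has at most four earlier states, whence \<open>4 ^ t\<close>.\<close>
  have b1: "real (card (B1 t)) \<le> ?N * (2 * (1 / 16) ^ t)" if "t > w" for t
  proof -
    have t: "t > 0" "48 * real k * (4 / r) \<le> real t"
      using that unfolding w_def by (linarith, simp) linarith
    have "real (card (B1 t)) \<le> real (card \<Omega>) * (real (k choose t) * (real 4 ^ t * (2 * real (card I) / r ^ t)))"
      unfolding B1_def T1_def
    proof (rule card_pairs_large_fragment[where \<rho> = "\<lambda>\<omega> Y. (fst \<omega> \<union> Y, snd \<omega> \<union> Y)" and V = V and H = H])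
      fix \<omega>' :: "'a set \<times> 'a set" and Y :: "'a set" assume Y: "Y \<subseteq> V"
      have "card {\<omega> \<in> \<Omega>. (fst \<omega> \<union> Y, snd \<omega> \<union> Y) = \<omega>' \<and> Y \<inter> (fst \<omega> \<inter> snd \<omega>) = {}}
        \<le> card {\<omega> \<in> Pow V \<times> Pow V. (fst \<omega> \<union> Y, snd \<omega> \<union> Y) = \<omega>'}"
        using fin by (intro card_mono) (auto simp: \<Omega>_def)
      also have "\<dots> \<le> 4 ^ card Y" by (rule card_pairs_Un_eq[OF fin(1) Y])
      finally show "card {\<omega> \<in> \<Omega>. (fst \<omega> \<union> Y, snd \<omega> \<union> Y) = \<omega>' \<and> Y \<inter> (fst \<omega> \<inter> snd \<omega>) = {}} \<le> 4 ^ card Y" .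
    next
      fix i assume "i \<in> I"
      then show "H i \<subseteq> V" using H by blast
    qed (use fin fin\<Omega> H sp r in \<open>simp_all add: \<Omega>_def Un_Int_distrib2 mem_Times_iff\<close>)
    also have "\<dots> = ?N * (2 * (real (k choose t) * (4 / r) ^ t))" by (simp add: power_divide)
    also have "\<dots> \<le> ?N * (2 * (1 / 16) ^ t)"
      using binomial_times_power_le[of t "4 / r" k] t r N0 by (intro mult_left_mono) auto
    finally show ?thesis .
  qed
  \<comment> \<open>The second round acts on the small fragments left by the first. They lie in the
    members \<open>H i\<close>, so the spreadness of \<open>H\<close> still applies.\<close>
  have b2: "real (card (B2 t)) \<le> ?N * (2 * (1 / 16) ^ t)" if "t > 0" for t
  proof -
    have "real (card (B2 t)) \<le> real (card \<Omega>) * (real (w choose t) * (real 2 ^ t * (2 * real (card I) / r ^ t)))"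
      unfolding B2_def T2_def
    proof (rule card_pairs_large_fragment[where \<rho> = "\<lambda>\<omega> Y. (fst \<omega> \<union> Y, snd \<omega> - Y)" and V = V and H = H])
      fix \<omega> i assume "\<omega> \<in> \<Omega>" "i \<in> J (fst \<omega> \<inter> snd \<omega>)"
      then show "T1 (fst \<omega> \<inter> snd \<omega>) i \<subseteq> H i \<and> card (T1 (fst \<omega> \<inter> snd \<omega>) i) \<le> w"
        using T1 unfolding J_def by blast
    next
      fix \<omega> :: "'a set \<times> 'a set" and Y :: "'a set"
      assume "\<omega> \<in> \<Omega>" "Y \<subseteq> V" "Y \<inter> fst \<omega> = {}"
      moreover from this have "(fst \<omega> \<union> Y) \<inter> (snd \<omega> - Y) = fst \<omega> \<inter> snd \<omega>" by auto
      ultimately show "(fst \<omega> \<union> Y, snd \<omega> - Y) \<in> \<Omega> \<and> fst (fst \<omega> \<union> Y, snd \<omega> - Y) = fst \<omega> \<union> Y \<and>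
        J (fst (fst \<omega> \<union> Y, snd \<omega> - Y) \<inter> snd (fst \<omega> \<union> Y, snd \<omega> - Y)) = J (fst \<omega> \<inter> snd \<omega>) \<and>
        T1 (fst (fst \<omega> \<union> Y, snd \<omega> - Y) \<inter> snd (fst \<omega> \<union> Y, snd \<omega> - Y)) = T1 (fst \<omega> \<inter> snd \<omega>)"
        by (auto simp: \<Omega>_def)
    next
      fix \<omega>' :: "'a set \<times> 'a set" and Y :: "'a set" assume Y: "Y \<subseteq> V"
      show "card {\<omega> \<in> \<Omega>. (fst \<omega> \<union> Y, snd \<omega> - Y) = \<omega>' \<and> Y \<inter> fst \<omega> = {}} \<le> 2 ^ card Y"
        unfolding \<Omega>_def by (rule card_pairs_Un_Diff_eq[OF fin(1) Y])
    next
      fix i assume "i \<in> I"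
      then show "H i \<subseteq> V" using H by blast
    next
      show "J (fst \<omega> \<inter> snd \<omega>) \<subseteq> I" for \<omega> by (auto simp: J_def)
    qed (use fin fin\<Omega> sp r in simp_all)
    also have "\<dots> = ?N * (2 * (real (w choose t) * (2 / r) ^ t))" by (simp add: power_divide)
    also have "\<dots> \<le> ?N * (2 * (1 / 16) ^ t)"
    proof (intro mult_left_mono)
      have "real (w choose t) * (2 / r) ^ t \<le> real w ^ t * (2 / r) ^ t"
        using r by (intro mult_right_mono binomial_le_power) auto
      also have "\<dots> = (real w * (2 / r)) ^ t" by (rule power_mult_distrib[symmetric])
      also have "\<dots> \<le> (1 / 16) ^ t"
      proof (intro power_mono)
        \<comment> \<open>Here \<open>384 = 2 * 192\<close>, and the hypothesis on \<open>r\<close>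
          has \<open>6144 = 16 * 384\<close>.\<close>
        have "real w \<le> 192 * real k / r" unfolding w_def using r by simp
        then have "real w * (2 / r) \<le> (192 * real k / r) * (2 / r)" using r by (intro mult_right_mono) auto
        also have "\<dots> = 384 * real k / r\<^sup>2" by (simp add: power2_eq_square)
        also have "\<dots> \<le> 1 / 16" using r by (simp add: divide_simps)
        finally show "real w * (2 / r) \<le> 1 / 16" .
      qed (use r in auto)
      finally show "real (w choose t) * (2 / r) ^ t \<le> (1 / 16) ^ t" .
    qed (use N0 in auto)
    finally show ?thesis .
  qed
  define Gd where "Gd = {\<omega>\<in>\<Omega>. \<exists>i\<in>I. H i \<subseteq> fst \<omega>}"
  \<comment> \<open>A pair falls outside the two bad events only if its second fragment is empty.
    Then some \<open>H l\<close> has its part outside \<open>W \<inter> U\<close> inside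
    \<open>W\<close>, so \<open>W\<close> contains \<open>H l\<close>.\<close>
  have cov: "\<Omega> \<times> I \<subseteq> (\<Union>t\<in>{w<..k}. B1 t) \<union> (\<Union>t\<in>{0<..w}. B2 t) \<union> Gd \<times> I"
  proof
    fix p assume "p \<in> \<Omega> \<times> I"
    then obtain \<omega> i where p: "p = (\<omega>, i)" "\<omega> \<in> \<Omega>" "i \<in> I" by auto
    let ?C = "fst \<omega> \<inter> snd \<omega>"
    have "card (T1 ?C i) \<le> card (H i)" by (rule card_mono[OF fH[OF p(3)] T1[OF p(3)]])
    then have k: "card (T1 ?C i) \<le> k" using H[OF p(3)] by auto
    show "p \<in> (\<Union>t\<in>{w<..k}. B1 t) \<union> (\<Union>t\<in>{0<..w}. B2 t) \<union> Gd \<times> I"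
    proof (cases "card (T1 ?C i) \<le> w")
      case False
      then show ?thesis using k p by (auto simp: B1_def)
    next
      case True
      then have iJ: "i \<in> J ?C" using p by (simp add: J_def)
      have fT: "finite (T1 ?C i)" by (rule finite_subset[OF T1[OF p(3)] fH[OF p(3)]])
      have T2: "T2 \<omega> i \<subseteq> T1 ?C i" unfolding T2_def by (rule min_fragment_subset[OF iJ])
      then have le: "card (T2 \<omega> i) \<le> w" using card_mono[OF fT T2] True by auto
      show ?thesis
      proof (cases "card (T2 \<omega> i) = 0")
        case False
        then show ?thesis using le p iJ by (auto simp: B2_def)
      next
        case True
        then have e: "T2 \<omega> i = {}" using finite_subset[OF T2 fT] by auto
        obtain j where j: "j \<in> J ?C" "T2 \<omega> i = T1 ?C j - fst \<omega>"
          unfolding T2_def by (rule min_fragment_source[OF iJ])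
        have "j \<in> I" using j by (simp add: J_def)
        then obtain l where l: "l \<in> I" "T1 ?C j = H l - ?C"
          using min_fragment_source unfolding T1_def by metis
        have "H l \<subseteq> fst \<omega>" using l j e by auto
        then show ?thesis using l p by (auto simp: Gd_def)
      qed
    qed
  qed
  have finB: "finite (B1 t)" "finite (B2 t)" "finite (Gd \<times> I)" for t
    using fin fin\<Omega> by (auto simp: B1_def B2_def J_def Gd_def)
  have "card (\<Omega> \<times> I) \<le> card ((\<Union>t\<in>{w<..k}. B1 t) \<union> (\<Union>t\<in>{0<..w}. B2 t) \<union> Gd \<times> I)"
    using cov finB by (intro card_mono) auto
  also have "\<dots> \<le> card (\<Union>t\<in>{w<..k}. B1 t) + card (\<Union>t\<in>{0<..w}. B2 t) + card (Gd \<times> I)"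
    by (meson add_right_mono card_Un_le order_trans)
  also have "\<dots> \<le> (\<Sum>t\<in>{w<..k}. card (B1 t)) + (\<Sum>t\<in>{0<..w}. card (B2 t)) + card (Gd \<times> I)"
    by (intro add_mono card_UN_le) auto
  finally have "real (card (\<Omega> \<times> I)) \<le> real ((\<Sum>t\<in>{w<..k}. card (B1 t)) + (\<Sum>t\<in>{0<..w}. card (B2 t)) + card (Gd \<times> I))"
    by (intro of_nat_mono)
  then have "?N \<le> (\<Sum>t\<in>{w<..k}. real (card (B1 t))) + (\<Sum>t\<in>{0<..w}. real (card (B2 t))) + real (card Gd) * real (card I)"
    unfolding of_nat_add of_nat_sum card_cartesian_product of_nat_mult .
  also have "\<dots> \<le> ?N * (2 / 15) + ?N * (2 / 15) + real (card Gd) * real (card I)"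
  proof (intro add_mono order_refl)
    have *: "(\<Sum>t\<in>A. ?N * (2 * (1 / 16) ^ t)) \<le> ?N * (2 / 15)" if "finite A" "0 \<notin> A" for A
    proof -
      have "(\<Sum>t\<in>A. ?N * (2 * (1 / 16) ^ t)) = ?N * 2 * (\<Sum>t\<in>A. (1 / 16) ^ t)"
        unfolding sum_distrib_left mult.assoc ..
      also have "\<dots> \<le> ?N * 2 * (1 / 15)"
        using N0 sum_power_16_le[OF that] by (intro mult_left_mono) auto
      finally show ?thesis by simp
    qed
    have "(\<Sum>t\<in>{w<..k}. real (card (B1 t))) \<le> (\<Sum>t\<in>{w<..k}. ?N * (2 * (1 / 16) ^ t))"
      by (rule sum_mono) (simp add: b1 del: of_nat_mult)
    also have "\<dots> \<le> ?N * (2 / 15)" by (rule *) auto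
    finally show "(\<Sum>t\<in>{w<..k}. real (card (B1 t))) \<le> ?N * (2 / 15)" .
    have "(\<Sum>t\<in>{0<..w}. real (card (B2 t))) \<le> (\<Sum>t\<in>{0<..w}. ?N * (2 * (1 / 16) ^ t))"
      by (rule sum_mono) (simp add: b2 del: of_nat_mult)
    also have "\<dots> \<le> ?N * (2 / 15)" by (rule *) auto
    finally show "(\<Sum>t\<in>{0<..w}. real (card (B2 t))) \<le> ?N * (2 / 15)" .
  qed
  \<comment> \<open>Each round loses a proportion of at most \<open>2 / 15\<close>, and the
    remaining \<open>11 / 15\<close> exceeds one half.\<close>
  finally have "real (card \<Omega>) * (11 / 15) * real (card I) \<le> real (card Gd) * real (card I)"
    by linarith
  then have ge: "real (card \<Omega>) * (11 / 15) \<le> real (card Gd)"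
    using I fin by (simp add: card_gt_0_iff)
  have "Gd = {W \<in> Pow V. \<exists>i\<in>I. H i \<subseteq> W} \<times> Pow V"
    unfolding Gd_def \<Omega>_def set_eq_iff by (simp add: mem_Times_iff conj_ac)
  then have "card Gd = card {W \<in> Pow V. \<exists>i\<in>I. H i \<subseteq> W} * 2 ^ card V"
    by (simp add: card_cartesian_product card_Pow fin)
  then have "2 ^ card V * (11 / 15) \<le> real (card {W \<in> Pow V. \<exists>i\<in>I. H i \<subseteq> W})"
    using ge by (simp add: card\<Omega>)
  moreover have "(2::real) ^ card V > 0" by simp
  ultimately have "2 ^ card V < 2 * real (card {W \<in> Pow V. \<exists>i\<in>I. H i \<subseteq> W})" by linarith
  then have "real (2 ^ card V) < real (2 * card {W \<in> Pow V. \<exists>i\<in>I. H i \<subseteq> W})" by simp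
  then show ?thesis unfolding of_nat_less_iff .
qed

text \<open>Each family has a member inside more than half of all subsets of \<open>V\<close>.
  Complementation is a bijection, so some \<open>W\<close> contains a member of one family while its
  complement contains a member of the other.\<close>

lemma spread_families_disjoint_members:
  fixes H :: "'i \<Rightarrow> 'a set" and H' :: "'j \<Rightarrow> 'a set" and r :: real
  assumes fin: "finite V" "finite I" "finite I'" and I: "I \<noteq> {}" "I' \<noteq> {}"
    and H: "\<And>i. i \<in> I \<Longrightarrow> H i \<subseteq> V \<and> card (H i) \<le> k"
    and H': "\<And>i. i \<in> I' \<Longrightarrow> H' i \<subseteq> V \<and> card (H' i) \<le> k"
    and sp: "spread 2 r I H" "spread 2 r I' H'" and r: "r > 0" "r\<^sup>2 \<ge> 6144 * real k"
  obtains i j where "i \<in> I" "j \<in> I'" "H i \<inter> H' j = {}"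
proof -
  define A where "A = {W \<in> Pow V. \<exists>i\<in>I. H i \<subseteq> W}"
  define B where "B = {W \<in> Pow V. \<exists>i\<in>I'. H' i \<subseteq> W}"
  define B' where "B' = (\<lambda>W. V - W) ` B"
  have a: "2 * card A > 2 ^ card V" unfolding A_def
    by (rule spread_covers_majority[OF fin(1,2) I(1) H sp(1) r])
  have b: "2 * card B > 2 ^ card V" unfolding B_def
    by (rule spread_covers_majority[OF fin(1,3) I(2) H' sp(2) r])
  have "inj_on (\<lambda>W. V - W) B" by (intro inj_onI) (auto simp: B_def)
  then have c: "card B' = card B" unfolding B'_def by (rule card_image)
  have "A \<inter> B' \<noteq> {}"
  proof
    assume e: "A \<inter> B' = {}"
    have "finite A" "finite B'" using fin by (auto simp: A_def B_def B'_def)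
    then have "card A + card B' = card (A \<union> B')" using e by (simp add: card_Un_disjoint)
    also have "\<dots> \<le> card (Pow V)" using fin by (intro card_mono) (auto simp: A_def B'_def)
    finally show False using a b c by (simp add: card_Pow fin)
  qed
  then obtain i j W where "i \<in> I" "H i \<subseteq> V - W" "j \<in> I'" "H' j \<subseteq> W"
    unfolding A_def B_def B'_def by blast
  then show ?thesis using that by blast
qed

subsection \<open>Spread approximation\<close>

abbreviation ksubsets :: "'a set \<Rightarrow> nat \<Rightarrow> 'a set set" where
  "ksubsets V k \<equiv> {A. A \<subseteq> V \<and> card A = k}"

lemma finite_ksubsets [simp]: "finite V \<Longrightarrow> finite (ksubsets V k)"
  by (rule finite_subset[of _ "Pow V"]) auto

lemma card_ksubsets: "finite V \<Longrightarrow> card (ksubsets V k) = card V choose k"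
  by (rule n_subsets)

section \<open>Counting the supersets of a fixed set\<close>

text \<open>Each further prescribed element costs a factor \<open>(N - x) / (n - x)\<close>, which
  is at most \<open>N / n\<close>.\<close>

lemma binomial_shift_le:
  assumes "N \<le> n" "x \<le> N"
  shows "real ((n - x) choose (N - x)) \<le> (real N / real n) ^ x * real (n choose N)"
  using assms(2)
proof (induction x)
  case (Suc x)
  obtain a where a: "N - x = Suc a" using Suc.prems by (cases "N - x") auto
  obtain b where b: "n - x = Suc b" using Suc.prems assms by (cases "n - x") auto
  have ab: "N - Suc x = a" "n - Suc x = b" using a b by auto
  have "Suc a * (Suc b choose Suc a) = Suc b * (b choose a)" by (rule Suc_times_binomial)
  then have eq: "real (Suc b) * real (b choose a) = real (Suc a) * real (Suc b choose Suc a)"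
    by (metis of_nat_mult)
  have "real (Suc a) = real N - real x" "real (Suc b) = real n - real x" using a b by linarith+
  then have "real (Suc a) * real n \<le> real N * real (Suc b)"
    using mult_right_mono[of "real N" "real n" "real x"] assms by (simp add: left_diff_distrib right_diff_distrib mult.commute)
  then have "real (Suc a) / real (Suc b) \<le> real N / real n"
    using b Suc.prems assms by (simp add: divide_simps mult.commute)
  moreover have "real (b choose a) = real (Suc a) / real (Suc b) * real (Suc b choose Suc a)"
    using eq by (simp add: field_simps del: of_nat_Suc binomial_Suc_Suc)
  ultimately have "real (b choose a) \<le> real N / real n * real (Suc b choose Suc a)"
    by (simp only:) (rule mult_right_mono; simp)
  also have "\<dots> \<le> real N / real n * ((real N / real n) ^ x * real (n choose N))"
    using Suc a b by (intro mult_left_mono) auto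
  finally show ?case unfolding ab by simp
qed simp

lemma card_supersets_eq:
  assumes "finite V" "X \<subseteq> V" "card X \<le> N"
  shows "card {S \<in> ksubsets V N. X \<subseteq> S} = (card V - card X) choose (N - card X)"
proof -
  have fX: "finite X" using assms finite_subset by auto
  have "bij_betw (\<lambda>S. S - X) {S \<in> ksubsets V N. X \<subseteq> S} (ksubsets (V - X) (N - card X))"
  proof (rule bij_betw_byWitness[where f' = "\<lambda>S. S \<union> X"])
    show "(\<lambda>S. S \<union> X) ` ksubsets (V - X) (N - card X) \<subseteq> {S \<in> ksubsets V N. X \<subseteq> S}"
    proof clarsimp
      fix S assume S: "S \<subseteq> V - X" "card S = N - card X"
      have "card (S \<union> X) = card S + card X"
        using S assms fX finite_subset[of S V] by (intro card_Un_disjoint) auto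
      then show "S \<subseteq> V \<and> X \<subseteq> V \<and> card (S \<union> X) = N" using S assms by auto
    qed
  qed (use fX assms in \<open>auto simp: card_Diff_subset\<close>)
  then have "card {S \<in> ksubsets V N. X \<subseteq> S} = card (ksubsets (V - X) (N - card X))"
    by (rule bij_betw_same_card)
  also have "\<dots> = card (V - X) choose (N - card X)" using assms by (intro card_ksubsets) auto
  finally show ?thesis using assms fX by (simp add: card_Diff_subset)
qed

lemma card_supersets_le:
  assumes "finite V" "X \<subseteq> V" "N \<le> card V"
  shows "real (card {S \<in> ksubsets V N. X \<subseteq> S}) \<le> (real N / real (card V)) ^ card X * real (card V choose N)"
proof (cases "card X \<le> N")
  case True
  then show ?thesis using binomial_shift_le[OF assms(3) True] card_supersets_eq[OF assms(1,2) True] by simp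
next
  case False
  have "card X \<le> card S" if "S \<subseteq> V" "X \<subseteq> S" for S
    using that assms(1) finite_subset by (intro card_mono) auto
  then have "{S \<in> ksubsets V N. X \<subseteq> S} = {}" using False by blast
  then show ?thesis by (simp only: card.empty) simp
qed

section \<open>Spread cores\<close>

text \<open>At most \<open>card I / r\<close> members contain a given point of \<open>Z\<close>, so
  at least half of the members avoid \<open>Z\<close>. Halving the index set doubles the constant,
  which is why the disjointness result is stated for constant 2.\<close>

lemma spread_avoiding:
  assumes sp: "spread 1 r I H" and fin: "finite I" "finite Z" and r: "r > 0" "2 * real (card Z) \<le> r"
  shows "card I \<le> 2 * card {i\<in>I. H i \<inter> Z = {}}"
    "spread 2 r {i\<in>I. H i \<inter> Z = {}} H"
proof -
  let ?I = "{i\<in>I. H i \<inter> Z = {}}"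
  have "I \<subseteq> ?I \<union> (\<Union>z\<in>Z. {i\<in>I. {z} \<subseteq> H i})" by auto
  then have "card I \<le> card (?I \<union> (\<Union>z\<in>Z. {i\<in>I. {z} \<subseteq> H i}))"
    by (rule card_mono[rotated]) (use fin in auto)
  also have "\<dots> \<le> card ?I + card (\<Union>z\<in>Z. {i\<in>I. {z} \<subseteq> H i})" by (rule card_Un_le)
  also have "\<dots> \<le> card ?I + (\<Sum>z\<in>Z. card {i\<in>I. {z} \<subseteq> H i})"
    by (intro add_left_mono card_UN_le fin)
  finally have "real (card I) \<le> real (card ?I + (\<Sum>z\<in>Z. card {i\<in>I. {z} \<subseteq> H i}))" by (rule of_nat_mono)
  also have "\<dots> = real (card ?I) + (\<Sum>z\<in>Z. real (card {i\<in>I. {z} \<subseteq> H i}))" by simp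
  also have "\<dots> \<le> real (card ?I) + (\<Sum>z\<in>Z. real (card I) / r)"
  proof (intro add_left_mono sum_mono)
    fix z
    show "real (card {i\<in>I. {z} \<subseteq> H i}) \<le> real (card I) / r"
      using sp[unfolded spread_def, rule_format, of "{z}"] r by (simp add: field_simps)
  qed
  also have "\<dots> = real (card ?I) + real (card I) * (real (card Z) / r)" by simp
  also have "\<dots> \<le> real (card ?I) + real (card I) * (1 / 2)"
    using r by (intro add_left_mono mult_left_mono) (simp_all add: divide_simps)
  finally have *: "real (card I) \<le> 2 * real (card ?I)" by linarith
  then show "card I \<le> 2 * card ?I" by linarith
  show "spread 2 r ?I H"
    unfolding spread_def
  proof (intro allI impI)
    fix Y :: "'b set" assume Y: "finite Y"
    have "card {i \<in> ?I. Y \<subseteq> H i} \<le> card {i \<in> I. Y \<subseteq> H i}" using fin by (intro card_mono) auto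
    then have "real (card {i \<in> ?I. Y \<subseteq> H i}) * r ^ card Y \<le> real (card {i \<in> I. Y \<subseteq> H i}) * r ^ card Y"
      using r by (intro mult_right_mono) auto
    also have "\<dots> \<le> 1 * real (card I)" using sp Y unfolding spread_def by blast
    finally show "real (card {i \<in> ?I. Y \<subseteq> H i}) * r ^ card Y \<le> 2 * real (card ?I)" using * by linarith
  qed
qed

text \<open>\<open>I\<close> is a mere index set, so members of \<open>F\<close> may occur with
  multiplicity. Its type suits \<open>spread_approximation\<close>, where the indices are
  \<open>N\<close>-sets.\<close>

definition spread_core :: "real \<Rightarrow> 'a set set \<Rightarrow> 'a set \<Rightarrow> bool" where
  "spread_core r F X \<longleftrightarrow> (\<exists>(I :: 'a set set) \<phi>. finite I \<and> I \<noteq> {} \<and>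
     (\<forall>i\<in>I. \<phi> i \<in> F \<and> X \<subseteq> \<phi> i) \<and> spread 1 r I (\<lambda>i. \<phi> i - X))"

text \<open>If the cores were disjoint, the links avoiding the opposite core would still be spread.
  Disjoint sets in these two links, completed by the cores, would give disjoint members of
  \<open>F\<close>.\<close>

lemma spread_cores_meet:
  assumes V: "finite V" and F: "F \<subseteq> ksubsets V k" "intersecting F"
    and X: "spread_core r F X" "2 * real (card X) \<le> r"
    and Y: "spread_core r F Y" "2 * real (card Y) \<le> r"
    and r: "r > 0" "r\<^sup>2 \<ge> 6144 * real k"
  shows "X \<inter> Y \<noteq> {}"
proof
  assume e: "X \<inter> Y = {}"
  obtain I :: "'a set set" and \<phi> where I: "finite I" "I \<noteq> {}" "\<And>i. i \<in> I \<Longrightarrow> \<phi> i \<in> F \<and> X \<subseteq> \<phi> i"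
    and spI: "spread 1 r I (\<lambda>i. \<phi> i - X)" using X unfolding spread_core_def by metis
  obtain J :: "'a set set" and \<psi> where J: "finite J" "J \<noteq> {}" "\<And>i. i \<in> J \<Longrightarrow> \<psi> i \<in> F \<and> Y \<subseteq> \<psi> i"
    and spJ: "spread 1 r J (\<lambda>i. \<psi> i - Y)" using Y unfolding spread_core_def by metis
  have fin: "finite A" if "A \<in> F" for A using that F V finite_subset by blast
  have fX: "finite X" "finite Y" using I J fin finite_subset by (metis ex_in_conv)+
  let ?I = "{i\<in>I. (\<phi> i - X) \<inter> Y = {}}" and ?J = "{j\<in>J. (\<psi> j - Y) \<inter> X = {}}"
  note I' = spread_avoiding[OF spI I(1) fX(2) r(1) Y(2)]
  note J' = spread_avoiding[OF spJ J(1) fX(1) r(1) X(2)]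
  have "card I > 0" "card J > 0" using I J by (auto simp: card_gt_0_iff)
  then have ne: "?I \<noteq> {}" "?J \<noteq> {}" using I'(1) J'(1) by (metis card.empty mult_0_right not_le)+
  have HI: "\<phi> i - X \<subseteq> V \<and> card (\<phi> i - X) \<le> k" if "i \<in> I" for i
    using I(3)[OF that] F fin card_mono[of "\<phi> i" "\<phi> i - X"] by auto
  have HJ: "\<psi> i - Y \<subseteq> V \<and> card (\<psi> i - Y) \<le> k" if "i \<in> J" for i
    using J(3)[OF that] F fin card_mono[of "\<psi> i" "\<psi> i - Y"] by auto
  obtain i j where ij: "i \<in> ?I" "j \<in> ?J" "(\<phi> i - X) \<inter> (\<psi> j - Y) = {}"
    by (rule spread_families_disjoint_members[OF V _ _ ne _ _ I'(2) J'(2) r]) (use I J HI HJ in auto)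
  then have "\<phi> i \<inter> \<psi> j = {}" using e by auto
  then show False using F(2) I(3) J(3) ij unfolding intersecting_def by blast
qed

text \<open>Members of \<open>F\<close> are weighted by the number of their \<open>N\<close>-element supersets, and a maximal set
  that is heavy for this weight has a spread link.\<close>

lemma spread_approximation:
  fixes V :: "'a set"
  assumes V: "finite V" and F: "F \<subseteq> ksubsets V k" and N: "N \<le> card V"
    and r: "r > 0" "r * real N / real (card V) \<le> 1"
    and R: "R = {K\<in>F. \<forall>X. X \<subseteq> K \<and> card X \<le> q \<longrightarrow> \<not> spread_core r F X}"
  shows "real (card {S \<in> ksubsets V N. \<exists>K\<in>R. K \<subseteq> S})
    \<le> (r * real N / real (card V)) ^ Suc q * real (card V choose N)"
proof -
  define D where "D = {S \<in> ksubsets V N. \<exists>K\<in>R. K \<subseteq> S}"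
  have finD: "finite D" using V by (auto simp: D_def)
  show ?thesis
  proof (cases "D = {}")
    case True
    then show ?thesis using r unfolding D_def[symmetric] by simp
  next
    case False
    have "\<exists>K. K \<in> R \<and> K \<subseteq> S" if "S \<in> D" for S using that unfolding D_def by blast
    then obtain \<phi> where \<phi>: "\<And>S. S \<in> D \<Longrightarrow> \<phi> S \<in> R \<and> \<phi> S \<subseteq> S" by metis
    define W where "W X = {S\<in>D. X \<subseteq> \<phi> S}" for X
    \<comment> \<open>\<open>X\<close> is heavy if the chosen member contains it for at least an
      \<open>r ^ (- card X)\<close> proportion of \<open>D\<close>. The empty set is heavy; a
      largest heavy set will be the core.\<close>
    let ?P = "\<lambda>X. X \<subseteq> V \<and> real (card D) \<le> real (card (W X)) * r ^ card X"
    have P0: "?P {}" by (simp add: W_def)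
    have "\<forall>X. ?P X \<longrightarrow> card X < Suc (card V)" using V by (auto intro: card_mono le_imp_less_Suc)
    from ex_has_greatest_nat[of ?P, OF P0 this]
    obtain X where X: "?P X" and max: "\<And>Y. ?P Y \<Longrightarrow> card Y \<le> card X" by auto
    have fX: "finite X" using X V finite_subset by auto
    have D0: "card D > 0" using False finD by (auto simp: card_gt_0_iff)
    then have W0: "W X \<noteq> {}" using X by auto
    have \<phi>V: "\<phi> S \<subseteq> V" if "S \<in> D" for S using \<phi>[OF that] F R by blast
    have "spread 1 r (W X) (\<lambda>S. \<phi> S - X)"
      unfolding spread_def
    proof (intro allI impI)
      fix Y :: "'a set" assume Y: "finite Y"
      let ?C = "{S \<in> W X. Y \<subseteq> \<phi> S - X}"
      show "real (card ?C) * r ^ card Y \<le> 1 * real (card (W X))"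
      proof (cases "Y = {} \<or> ?C = {}")
        case True
        then consider "Y = {}" | "?C = {}" by blast
        then show ?thesis
        proof cases
          case 2
          show ?thesis unfolding 2 by simp
        qed simp
      next
        case ne: False
        then obtain S where S: "S \<in> D" "Y \<subseteq> \<phi> S - X" unfolding W_def by auto
        then have Y': "Y \<inter> X = {}" "Y \<subseteq> V" using \<phi>V[OF S(1)] by auto
        then have cXY: "card (X \<union> Y) = card X + card Y" using fX Y by (subst card_Un_disjoint) auto
        have "card Y > 0" using ne Y by (auto simp: card_gt_0_iff)
        \<comment> \<open>Comparing the weight of \<open>X\<close>, which is heavy, with that of
          \<open>X \<union> Y\<close>, which by maximality is not, yields the spreadness inequality
          at \<open>Y\<close>.\<close>
        then have "\<not> ?P (X \<union> Y)" using max[of "X \<union> Y"] cXY by linarith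
        moreover have "W (X \<union> Y) = ?C" using Y' by (auto simp: W_def)
        ultimately have "real (card ?C) * r ^ (card X + card Y) < real (card D)"
          using X Y' cXY by auto
        also have "\<dots> \<le> real (card (W X)) * r ^ card X" using X by auto
        finally have "(real (card ?C) * r ^ card Y) * r ^ card X \<le> real (card (W X)) * r ^ card X"
          by (simp add: power_add mult_ac)
        then show ?thesis using r by simp
      qed
    qed
    moreover have "finite (W X)" using finD by (simp add: W_def)
    moreover have "\<phi> S \<in> F \<and> X \<subseteq> \<phi> S" if "S \<in> W X" for S using that \<phi> R by (auto simp: W_def)
    ultimately have core: "spread_core r F X" unfolding spread_core_def using W0 by blast
    obtain S where "S \<in> W X" using W0 by auto
    then have "\<phi> S \<in> R" "X \<subseteq> \<phi> S" using \<phi> by (auto simp: W_def)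
    \<comment> \<open>A member of \<open>R\<close> contains no spread core of size at most
      \<open>q\<close>. So \<open>X\<close> is large and has few supersets, while heaviness bounds
      \<open>card D\<close> by \<open>r ^ card X\<close> times their number.\<close>
    then have q: "Suc q \<le> card X" using core R by auto
    have "W X \<subseteq> {S \<in> ksubsets V N. X \<subseteq> S}" using \<phi> by (auto simp: W_def D_def)
    then have "card (W X) \<le> card {S \<in> ksubsets V N. X \<subseteq> S}" using V by (intro card_mono) auto
    then have "real (card (W X)) \<le> (real N / real (card V)) ^ card X * real (card V choose N)"
      using card_supersets_le[OF V _ N, of X] X by linarith
    then have "real (card (W X)) * r ^ card X
      \<le> ((real N / real (card V)) ^ card X * real (card V choose N)) * r ^ card X"
      using r by (intro mult_right_mono) auto
    also have "\<dots> = (r * real N / real (card V)) ^ card X * real (card V choose N)"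
      by (simp add: power_mult_distrib power_divide)
    also have "\<dots> \<le> (r * real N / real (card V)) ^ Suc q * real (card V choose N)"
      using r q by (intro mult_right_mono power_decreasing) auto
    finally show ?thesis using X unfolding D_def by linarith
  qed
qed

subsection \<open>Kernels of intersecting families\<close>

text \<open>A search tree of depth \<open>j\<close>: as long as \<open>b\<close> is not a cover, it
  is extended by each element of a member disjoint from it. Every \<open>t\<close> in
  \<open>T\<close> meets that member, so one branch stays inside \<open>t\<close>.\<close>

lemma cover_branching:
  assumes T: "intersecting T" "\<And>t. t \<in> T \<Longrightarrow> finite t \<and> card t \<le> q" and q: "q > 0"
  shows "\<exists>B. finite B \<and> card B \<le> q ^ j \<and>
    (\<forall>b\<in>B. finite b \<and> card b \<le> j \<and> (is_cover b T \<or> card b = j)) \<and> (\<forall>t\<in>T. \<exists>b\<in>B. b \<subseteq> t)"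
proof (induction j)
  case 0
  show ?case by (intro exI[of _ "{{}}"]) auto
next
  case (Suc j)
  then obtain B where B: "finite B" "card B \<le> q ^ j"
    "\<And>b. b \<in> B \<Longrightarrow> finite b \<and> card b \<le> j \<and> (is_cover b T \<or> card b = j)"
    "\<And>t. t \<in> T \<Longrightarrow> \<exists>b\<in>B. b \<subseteq> t" by metis
  have "\<exists>t\<in>T. b \<inter> t = {}" if "\<not> is_cover b T" for b using that by (auto simp: is_cover_def)
  then obtain g where g: "\<And>b. \<not> is_cover b T \<Longrightarrow> g b \<in> T \<and> b \<inter> g b = {}" by metis
  define C where "C b = (if is_cover b T then {b} else (\<lambda>v. insert v b) ` g b)" for b
  have C: "finite (C b) \<and> card (C b) \<le> q" for b
  proof (cases "is_cover b T")
    case False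
    have "card (C b) \<le> card (g b)" using False T(2) g by (auto simp: C_def intro: card_image_le)
    then show ?thesis using False g[OF False] T(2) order_trans by (fastforce simp: C_def)
  qed (use q in \<open>auto simp: C_def\<close>)
  show ?case
  proof (intro exI[of _ "\<Union>b\<in>B. C b"] conjI ballI)
    show "finite (\<Union>b\<in>B. C b)" using B C by auto
    have "card (\<Union>b\<in>B. C b) \<le> (\<Sum>b\<in>B. card (C b))" using B by (intro card_UN_le)
    also have "\<dots> \<le> card B * q" using C sum_bounded_above[of B "\<lambda>b. card (C b)" q] by auto
    also have "\<dots> \<le> q ^ j * q" using B by simp
    finally show "card (\<Union>b\<in>B. C b) \<le> q ^ Suc j" by (simp add: mult.commute)
  next
    fix c assume "c \<in> (\<Union>b\<in>B. C b)"
    then obtain b where b: "b \<in> B" "c \<in> C b" by auto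
    have "finite c \<and> card c \<le> Suc j \<and> (is_cover c T \<or> card c = Suc j)"
    proof (cases "is_cover b T")
      case True
      then show ?thesis using b B(3)[OF b(1)] by (auto simp: C_def)
    next
      case False
      then obtain v where "v \<in> g b" "c = insert v b" using b by (auto simp: C_def)
      moreover from this have "v \<notin> b" using g[OF False] by auto
      ultimately show ?thesis using B(3)[OF b(1)] False by auto
    qed
    then show "finite c" "card c \<le> Suc j" "is_cover c T \<or> card c = Suc j" by auto
  next
    fix t assume t: "t \<in> T"
    then obtain b where b: "b \<in> B" "b \<subseteq> t" using B(4) by auto
    show "\<exists>c\<in>\<Union>b\<in>B. C b. c \<subseteq> t"
    proof (cases "is_cover b T")
      case True
      then show ?thesis using b by (auto simp: C_def)
    next
      case False
      have "t \<inter> g b \<noteq> {}" using T(1) t g[OF False] unfolding intersecting_def by blast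
      then obtain v where "v \<in> t" "v \<in> g b" by auto
      then have "insert v b \<in> C b" "insert v b \<subseteq> t" using b False by (auto simp: C_def)
      then show ?thesis using b by blast
    qed
  qed
qed

text \<open>At depth \<open>q\<close> a non-cover has \<open>q\<close> elements. If it lies in a
  member it equals that member, which is a cover because \<open>T\<close> is intersecting. Hence
  keeping only the sets inside members leaves only covers.\<close>

lemma intersecting_kernel:
  assumes T: "intersecting T" "\<And>t. t \<in> T \<Longrightarrow> finite t \<and> card t \<le> q" and q: "q > 0"
  obtains B where "finite B" "card B \<le> q ^ q" "\<And>t. t \<in> T \<Longrightarrow> \<exists>b\<in>B. b \<subseteq> t"
    "\<And>b. b \<in> B \<Longrightarrow> is_cover b T \<and> (\<exists>t\<in>T. b \<subseteq> t)"
proof -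
  obtain B where B: "finite B" "card B \<le> q ^ q"
    "\<And>b. b \<in> B \<Longrightarrow> finite b \<and> card b \<le> q \<and> (is_cover b T \<or> card b = q)"
    "\<And>t. t \<in> T \<Longrightarrow> \<exists>b\<in>B. b \<subseteq> t"
    using cover_branching[OF T q, of q] by metis
  let ?B = "{b\<in>B. \<exists>t\<in>T. b \<subseteq> t}"
  have "card ?B \<le> card B" using B(1) by (intro card_mono) auto
  moreover have "is_cover b T" if b: "b \<in> B" "t \<in> T" "b \<subseteq> t" for b t
  proof (rule ccontr)
    assume n: "\<not> is_cover b T"
    then have "card b = q" using B(3)[OF b(1)] by auto
    then have "b = t" using T(2)[OF b(2)] b(3) by (intro card_seteq) auto
    then show False using n T(1) b(2) unfolding is_cover_def intersecting_def by blast
  qed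
  ultimately show ?thesis using B by (intro that[of ?B]) (auto, blast)
qed

subsection \<open>Non-trivial intersecting families\<close>

lemma nontrivial_not_covered:
  assumes "nontrivial_intersecting F"
  obtains A where "A \<in> F" "x \<notin> A"
proof -
  have "\<not> is_cover {x} F"
  proof
    assume c: "is_cover {x} F"
    have "covering_number F \<le> 1"
      unfolding covering_number_def by (rule Least_le) (use c in \<open>auto intro!: exI[of _ "{x}"]\<close>)
    then show False using assms by (simp add: nontrivial_intersecting_def)
  qed
  then show ?thesis using that by (auto simp: is_cover_def)
qed

text \<open>Cores of size up to four are used because the remaining loss is then a fifth power: with
  \<open>r\<close> of order \<open>sqrt k\<close> and \<open>k\<^sup>2 <= n\<close>, the fourth
  power of \<open>r * N / n\<close> would only be \<open>O(1 / n)\<close>. The condition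
  \<open>r >= 8\<close> is twice the core size, as \<open>spread_cores_meet\<close> demands.\<close>

lemma nontrivial_intersecting_structure:
  fixes V :: "'a set"
  assumes V: "finite V" and F: "F \<subseteq> ksubsets V k" "nontrivial_intersecting F" and N: "N \<le> card V"
    and r: "r \<ge> 8" "r\<^sup>2 \<ge> 6144 * real k" "r * real N / real (card V) \<le> 1"
  obtains E B where "E \<subseteq> ksubsets V 2" "card E \<le> k + 256" "B \<subseteq> ksubsets V N"
    "real (card B) \<le> (256 * (real N / real (card V)) ^ 3 + (r * real N / real (card V)) ^ 5)
       * real (card V choose N)"
    "\<And>K S. K \<in> F \<Longrightarrow> K \<subseteq> S \<Longrightarrow> S \<in> ksubsets V N - B \<Longrightarrow> \<exists>e\<in>E. e \<subseteq> K"
proof -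
  have int: "intersecting F" using F by (simp add: nontrivial_intersecting_def)
  define T where "T = {X. (\<exists>K\<in>F. X \<subseteq> K) \<and> card X \<le> 4 \<and> spread_core r F X}"
  define R where "R = {K\<in>F. \<forall>X. X \<subseteq> K \<and> card X \<le> 4 \<longrightarrow> \<not> spread_core r F X}"
  define D where "D = {S \<in> ksubsets V N. \<exists>K\<in>R. K \<subseteq> S}"
  let ?p = "real N / real (card V)" and ?c = "real (card V choose N)"
  have "real (card D) \<le> (r * real N / real (card V)) ^ Suc 4 * ?c"
    unfolding D_def by (rule spread_approximation[OF V F(1) N _ r(3) R_def]) (use r in simp)
  then have D: "real (card D) \<le> (r * real N / real (card V)) ^ 5 * ?c" by simp
  have found: "\<exists>X\<in>T. X \<subseteq> K" if "K \<in> F" "K \<subseteq> S" "S \<in> ksubsets V N - D" for K S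
    using that unfolding D_def R_def T_def by blast
  have T: "finite t \<and> card t \<le> 4" "t \<subseteq> V" if "t \<in> T" for t
  proof -
    show "t \<subseteq> V" using that F unfolding T_def by blast
    then show "finite t \<and> card t \<le> 4" using that V finite_subset unfolding T_def by auto
  qed
  have "X \<inter> Y \<noteq> {}" if "X \<in> T" "Y \<in> T" for X Y
    by (rule spread_cores_meet[OF V F(1) int, of r]) (use that r in \<open>auto simp: T_def\<close>)
  then have "intersecting T" by (auto simp: intersecting_def)
  \<comment> \<open>The kernel has at most \<open>4 ^ 4 = 256\<close> sets, the source of this
    constant in all later bounds.\<close>
  from intersecting_kernel[of T 4, OF this T(1)]
  obtain B where B: "finite B" "card B \<le> 4 ^ 4" "\<And>t. t \<in> T \<Longrightarrow> \<exists>b\<in>B. b \<subseteq> t"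
    "\<And>b. b \<in> B \<Longrightarrow> is_cover b T \<and> (\<exists>t\<in>T. b \<subseteq> t)"
    by auto
  have BV: "b \<subseteq> V" "finite b" if "b \<in> B" for b
  proof -
    show "b \<subseteq> V" using B(4)[OF that] T(2) by blast
    then show "finite b" using V finite_subset by auto
  qed
  show ?thesis
  proof (cases "\<exists>x. {x} \<in> B")
    case True
    then obtain x where x: "{x} \<in> B" by auto
    have xV: "x \<in> V" using BV[OF x] by auto
    \<comment> \<open>All cores contain \<open>x\<close>, because \<open>{x}\<close> covers them.
      Non-triviality gives a member \<open>A\<close> without \<open>x\<close>; every other member
      meets \<open>A\<close>, hence contains some edge \<open>{x, a}\<close> as soon as it contains
      a core.\<close>
    obtain A where A: "A \<in> F" "x \<notin> A" using nontrivial_not_covered[OF F(2)] .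
    have A': "A \<subseteq> V" "card A = k" using F(1) A(1) by auto
    then have finA: "finite A" using V finite_subset by auto
    show ?thesis
    proof (rule that[of "(\<lambda>a. {x, a}) ` A" D])
      show "(\<lambda>a. {x, a}) ` A \<subseteq> ksubsets V 2" using A A' xV by (auto simp: card_2_iff)
      show "card ((\<lambda>a. {x, a}) ` A) \<le> k + 256"
        using card_image_le[OF finA, of "\<lambda>a. {x, a}"] A' by auto
      show "D \<subseteq> ksubsets V N" by (auto simp: D_def)
      have "256 * ?p ^ 3 * ?c \<ge> 0" by simp
      then show "real (card D) \<le> (256 * ?p ^ 3 + (r * real N / real (card V)) ^ 5) * ?c"
        using D unfolding distrib_right by linarith
      fix K S assume K: "K \<in> F" "K \<subseteq> S" "S \<in> ksubsets V N - D"
      then obtain X where X: "X \<in> T" "X \<subseteq> K" using found by blast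
      have "x \<in> X" using B(4)[OF x] X(1) unfolding is_cover_def by blast
      moreover obtain a where "a \<in> K" "a \<in> A" using int K(1) A(1) unfolding intersecting_def by blast
      ultimately show "\<exists>e\<in>(\<lambda>a. {x, a}) ` A. e \<subseteq> K" using X by auto
    qed
  next
    case False
    \<comment> \<open>Without singletons, the kernel sets of size two become the edges, and the
      \<open>N\<close>-sets that contain a larger kernel set are declared bad.\<close>
    define U where "U = (\<Union>b\<in>{b\<in>B. 3 \<le> card b}. {S \<in> ksubsets V N. b \<subseteq> S})"
    have p: "0 \<le> ?p" "?p \<le> 1" using N by (auto simp: divide_simps)
    have "card U \<le> (\<Sum>b\<in>{b\<in>B. 3 \<le> card b}. card {S \<in> ksubsets V N. b \<subseteq> S})"
      unfolding U_def using B by (intro card_UN_le) auto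
    then have "real (card U) \<le> real (\<Sum>b\<in>{b\<in>B. 3 \<le> card b}. card {S \<in> ksubsets V N. b \<subseteq> S})"
      by (rule of_nat_mono)
    also have "\<dots> = (\<Sum>b\<in>{b\<in>B. 3 \<le> card b}. real (card {S \<in> ksubsets V N. b \<subseteq> S}))" by simp
    also have "\<dots> \<le> (\<Sum>b\<in>{b\<in>B. 3 \<le> card b}. ?p ^ 3 * ?c)"
    proof (rule sum_mono)
      fix b assume b: "b \<in> {b\<in>B. 3 \<le> card b}"
      have "real (card {S \<in> ksubsets V N. b \<subseteq> S}) \<le> ?p ^ card b * ?c"
        by (rule card_supersets_le[OF V _ N]) (use BV b in auto)
      also have "\<dots> \<le> ?p ^ 3 * ?c"
        using b p by (intro mult_right_mono power_decreasing) auto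
      finally show "real (card {S \<in> ksubsets V N. b \<subseteq> S}) \<le> ?p ^ 3 * ?c" .
    qed
    also have "\<dots> = real (card {b\<in>B. 3 \<le> card b}) * (?p ^ 3 * ?c)" by (rule sum_constant)
    also have "\<dots> \<le> 256 * (?p ^ 3 * ?c)"
    proof (rule mult_right_mono)
      have "card {b\<in>B. 3 \<le> card b} \<le> card B" using B by (intro card_mono) auto
      then show "real (card {b\<in>B. 3 \<le> card b}) \<le> 256" using B(2) by simp
    qed simp
    finally have U: "real (card U) \<le> 256 * ?p ^ 3 * ?c" by (simp only: mult.assoc)
    have two: "card b \<ge> 2" if b: "b \<in> B" for b
    proof -
      \<comment> \<open>\<open>b\<close> lies in a member of \<open>T\<close>, so \<open>T\<close>
        is nonempty and has no empty cover.\<close>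
      have "b \<noteq> {}" using B(4)[OF b] unfolding is_cover_def by blast
      moreover have "card b \<noteq> 1" using False b by (metis card_1_singletonE)
      ultimately show ?thesis using BV(2)[OF b] by (cases "card b") auto
    qed
    show ?thesis
    proof (rule that[of "{b\<in>B. card b = 2}" "D \<union> U"])
      show "{b \<in> B. card b = 2} \<subseteq> ksubsets V 2" using BV by auto
      have "card {b \<in> B. card b = 2} \<le> card B" using B by (intro card_mono) auto
      then show "card {b \<in> B. card b = 2} \<le> k + 256" using B(2) by simp
      show "D \<union> U \<subseteq> ksubsets V N" by (auto simp: D_def U_def)
      have "card (D \<union> U) \<le> card D + card U" by (rule card_Un_le)
      then have "real (card (D \<union> U)) \<le> real (card D) + real (card U)" by (metis of_nat_add of_nat_mono)
      then show "real (card (D \<union> U)) \<le> (256 * ?p ^ 3 + (r * real N / real (card V)) ^ 5) * ?c"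
        using D U unfolding distrib_right by linarith
      fix K S assume K: "K \<in> F" "K \<subseteq> S" "S \<in> ksubsets V N - (D \<union> U)"
      then obtain X where X: "X \<in> T" "X \<subseteq> K" using found by blast
      then obtain b where b: "b \<in> B" "b \<subseteq> X" using B(3) by blast
      have "\<not> 3 \<le> card b" using K X b unfolding U_def by blast
      then show "\<exists>e\<in>{b \<in> B. card b = 2}. e \<subseteq> K" using b X two[OF b(1)] by force
    qed
  qed
qed

subsection \<open>The Moon--Moser inequality, averaged over a family of vertex sets\<close>

lemma real_Suc_times_binomial_Suc:
  assumes "k \<le> m"
  shows "real (Suc k) * real (m choose Suc k) = (real m - real k) * real (m choose k)"
proof -
  have "Suc k * (m choose Suc k) = (m - k) * (m choose k)"
    by (metis binomial_absorption binomial_absorb_comp mult.commute)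
  then have "real (Suc k * (m choose Suc k)) = real ((m - k) * (m choose k))" by (rule arg_cong)
  then show ?thesis using assms by (simp only: of_nat_mult of_nat_diff)
qed

definition edge_free :: "'a set set \<Rightarrow> 'a set \<Rightarrow> bool" where
  "edge_free E A \<longleftrightarrow> (\<forall>e\<in>E. \<not> e \<subseteq> A)"

text \<open>These are the independent \<open>j\<close>-sets of the graphs that \<open>E\<close>
  induces on the sets in \<open>\<S>\<close>, collected with their host.\<close>

definition free_pairs :: "'a set set \<Rightarrow> 'a set set \<Rightarrow> nat \<Rightarrow> ('a set \<times> 'a set) set" where
  "free_pairs \<S> E j = (SIGMA S:\<S>. {A. A \<subseteq> S \<and> card A = j \<and> edge_free E A})"

definition free_exts :: "'a set set \<Rightarrow> 'a set \<times> 'a set \<Rightarrow> 'a set" where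
  "free_exts E p = {v \<in> fst p - snd p. edge_free E (insert v (snd p))}"

lemma edge_free_subset: "edge_free E A \<Longrightarrow> B \<subseteq> A \<Longrightarrow> edge_free E B"
  unfolding edge_free_def by blast

context
  fixes \<S> E :: "'a set set" and N :: nat
  assumes fin: "finite \<S>" and S: "\<And>S. S \<in> \<S> \<Longrightarrow> finite S \<and> card S = N"
    and E: "\<And>e. e \<in> E \<Longrightarrow> card e = 2"
begin

lemma finite_free_pairs: "finite (free_pairs \<S> E j)"
  unfolding free_pairs_def using fin S
  by (intro finite_SigmaI) (auto intro: finite_subset[of _ "Pow _"])

lemma free_pairsD:
  assumes "p \<in> free_pairs \<S> E j"
  shows "fst p \<in> \<S>" "snd p \<subseteq> fst p" "card (snd p) = j" "edge_free E (snd p)"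
    "finite (fst p)" "finite (snd p)" "card (fst p) = N" "finite (free_exts E p)"
proof -
  show *: "fst p \<in> \<S>" "snd p \<subseteq> fst p" "card (snd p) = j" "edge_free E (snd p)"
    using assms by (auto simp: free_pairs_def)
  show **: "finite (fst p)" "card (fst p) = N" using S * by auto
  show "finite (snd p)" using * ** finite_subset by auto
  show "finite (free_exts E p)" using ** by (simp add: free_exts_def)
qed

lemma sum_free_exts:
  "(\<Sum>p\<in>free_pairs \<S> E j. card (free_exts E p)) = Suc j * card (free_pairs \<S> E (Suc j))"
proof -
  let ?L = "SIGMA p:free_pairs \<S> E j. free_exts E p"
  let ?R = "SIGMA p:free_pairs \<S> E (Suc j). snd p"
  have "bij_betw (\<lambda>(p, v). ((fst p, insert v (snd p)), v)) ?L ?R"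
  proof (rule bij_betw_byWitness[where f' = "\<lambda>(p, v). ((fst p, snd p - {v}), v)"])
    show "\<forall>x\<in>?L. (\<lambda>(p, v). ((fst p, snd p - {v}), v)) ((\<lambda>(p, v). ((fst p, insert v (snd p)), v)) x) = x"
      by (auto simp: free_exts_def)
    show "\<forall>x\<in>?R. (\<lambda>(p, v). ((fst p, insert v (snd p)), v)) ((\<lambda>(p, v). ((fst p, snd p - {v}), v)) x) = x"
      by auto
    show "(\<lambda>(p, v). ((fst p, insert v (snd p)), v)) ` ?L \<subseteq> ?R"
    proof clarsimp
      fix X A v assume p: "(X, A) \<in> free_pairs \<S> E j" and v: "v \<in> free_exts E (X, A)"
      have "finite A" using free_pairsD(6)[OF p] by simp
      then show "(X, insert v A) \<in> free_pairs \<S> E (Suc j)"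
        using p v by (auto simp: free_exts_def free_pairs_def)
    qed
    show "(\<lambda>(p, v). ((fst p, snd p - {v}), v)) ` ?R \<subseteq> ?L"
    proof clarsimp
      fix X A v assume p: "(X, A) \<in> free_pairs \<S> E (Suc j)" and v: "v \<in> A"
      have A: "finite A" "A \<subseteq> X" "card A = Suc j" "edge_free E A" "X \<in> \<S>"
        using free_pairsD[OF p] by auto
      have "(X, A - {v}) \<in> free_pairs \<S> E j"
        using A v edge_free_subset[OF A(4), of "A - {v}"] by (auto simp: free_pairs_def)
      moreover have "v \<in> free_exts E (X, A - {v})"
        using A v by (auto simp: free_exts_def insert_absorb)
      ultimately show "(X, A - {v}) \<in> free_pairs \<S> E j \<and> v \<in> free_exts E (X, A - {v})" ..
    qed
  qed
  then have "card ?L = card ?R" by (rule bij_betw_same_card)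
  moreover have "card ?L = (\<Sum>p\<in>free_pairs \<S> E j. card (free_exts E p))"
    by (rule card_SigmaI[OF finite_free_pairs]) (use free_pairsD in blast)
  moreover have "card ?R = (\<Sum>p\<in>free_pairs \<S> E (Suc j). card (snd p))"
    by (rule card_SigmaI[OF finite_free_pairs]) (use free_pairsD in blast)
  moreover have "(\<Sum>p\<in>free_pairs \<S> E (Suc j). card (snd p)) = (\<Sum>p\<in>free_pairs \<S> E (Suc j). Suc j)"
    by (rule sum.cong) (auto dest: free_pairsD(3))
  ultimately show ?thesis by simp
qed

text \<open>The edge that blocks \<open>v\<close> is \<open>{v, w}\<close> with a single
  \<open>w\<close> in \<open>A\<close>, and only the removal of \<open>w\<close> can unblock
  \<open>v\<close>.\<close>

lemma blocked_at_most_one: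
  assumes "edge_free E A" "\<not> edge_free E (insert v A)" "v \<notin> A"
    "edge_free E (insert v (A - {u}))" "edge_free E (insert v (A - {u'}))"
  shows "u = u'"
proof (rule ccontr)
  assume n: "u \<noteq> u'"
  obtain e where e: "e \<in> E" "e \<subseteq> insert v A" using assms(2) by (auto simp: edge_free_def)
  have "v \<in> e" using e assms(1) by (auto simp: edge_free_def)
  then obtain w where "e = {v, w}" using E[OF e(1)] by (auto simp: card_2_iff)
  then have "e \<subseteq> insert v (A - {u}) \<or> e \<subseteq> insert v (A - {u'})" using e n by auto
  then show False using assms(4,5) e by (auto simp: edge_free_def)
qed

text \<open>Count triples of a free set \<open>A\<close> of size \<open>j + 1\<close>, a blocked
  \<open>v\<close>, and a \<open>u\<close> in \<open>A\<close> whose removal keeps \<open>v\<close>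
  blocked. By \<open>blocked_at_most_one\<close> each \<open>v\<close> has at least \<open>j\<close>
  such \<open>u\<close>. Relative to \<open>A - {u}\<close>, \<open>v\<close> is blocked and
  \<open>u\<close> is a free extension, which gives the product on the right.\<close>

lemma free_pairs_double_count:
  "j * (\<Sum>p\<in>free_pairs \<S> E (Suc j). N - Suc j - card (free_exts E p))
    \<le> (\<Sum>p\<in>free_pairs \<S> E j. card (free_exts E p) * (N - j - card (free_exts E p)))"
proof -
  define X where "X p = (SIGMA v:fst p - snd p - free_exts E p.
      {u \<in> snd p. \<not> edge_free E (insert v (snd p - {u}))})" for p
  define Y where "Y p = (fst p - snd p - free_exts E p) \<times> free_exts E p" for p
  let ?L = "SIGMA p:free_pairs \<S> E (Suc j). X p"
  let ?R = "SIGMA p:free_pairs \<S> E j. Y p"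
  have compl: "card (fst p - snd p - free_exts E p) = N - i - card (free_exts E p)"
    if p: "p \<in> free_pairs \<S> E i" for p i
  proof -
    note d = free_pairsD[OF p]
    have "card (fst p - snd p) = N - i" using d by (simp add: card_Diff_subset)
    moreover have "free_exts E p \<subseteq> fst p - snd p" by (auto simp: free_exts_def)
    ultimately show ?thesis using d by (simp add: card_Diff_subset)
  qed
  have finX: "finite (X p)" if "p \<in> free_pairs \<S> E i" for p i
    unfolding X_def using free_pairsD[OF that] by (intro finite_SigmaI) auto
  have finY: "finite (Y p)" if "p \<in> free_pairs \<S> E i" for p i
    unfolding Y_def using free_pairsD[OF that] by auto
  have "card ?L \<le> card ?R"
  proof (rule card_inj_on_le)
    show "inj_on (\<lambda>(p, (v, u)). ((fst p, snd p - {u}), (v, u))) ?L"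
    proof (rule inj_onI, clarsimp simp: X_def)
      fix A B :: "'a set" and u
      assume "u \<in> A" "u \<in> B" "A - {u} = B - {u}"
      then show "A = B" by blast
    qed
    show "(\<lambda>(p, (v, u)). ((fst p, snd p - {u}), (v, u))) ` ?L \<subseteq> ?R"
    proof clarsimp
      fix Z A v u assume p: "(Z, A) \<in> free_pairs \<S> E (Suc j)" and vu: "(v, u) \<in> X (Z, A)"
      have A: "finite A" "A \<subseteq> Z" "card A = Suc j" "edge_free E A" "Z \<in> \<S>"
        using free_pairsD[OF p] by auto
      have u: "u \<in> A" "v \<in> Z" "v \<notin> A" "\<not> edge_free E (insert v (A - {u}))"
        using vu by (auto simp: X_def)
      have "(Z, A - {u}) \<in> free_pairs \<S> E j"
        using A u edge_free_subset[OF A(4), of "A - {u}"] by (auto simp: free_pairs_def)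
      moreover have "u \<in> free_exts E (Z, A - {u})"
        using A u by (auto simp: free_exts_def insert_absorb)
      moreover have "v \<in> Z - (A - {u}) - free_exts E (Z, A - {u})"
        using u by (auto simp: free_exts_def)
      ultimately show "(Z, A - {u}) \<in> free_pairs \<S> E j \<and> (v, u) \<in> Y (Z, A - {u})"
        by (simp add: Y_def)
    qed
    show "finite ?R" by (intro finite_SigmaI finite_free_pairs finY)
  qed
  moreover have "card ?R = (\<Sum>p\<in>free_pairs \<S> E j. card (Y p))"
    by (rule card_SigmaI[OF finite_free_pairs]) (blast intro: finY)
  moreover have "(\<Sum>p\<in>free_pairs \<S> E j. card (Y p))
      = (\<Sum>p\<in>free_pairs \<S> E j. card (free_exts E p) * (N - j - card (free_exts E p)))"
    by (rule sum.cong) (auto simp: Y_def card_cartesian_product compl)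
  moreover have "card ?L = (\<Sum>p\<in>free_pairs \<S> E (Suc j). card (X p))"
    by (rule card_SigmaI[OF finite_free_pairs]) (blast intro: finX)
  moreover have "j * (\<Sum>p\<in>free_pairs \<S> E (Suc j). N - Suc j - card (free_exts E p))
      \<le> (\<Sum>p\<in>free_pairs \<S> E (Suc j). card (X p))"
    unfolding sum_distrib_left
  proof (rule sum_mono)
    fix p assume p: "p \<in> free_pairs \<S> E (Suc j)"
    note d = free_pairsD[OF p]
    have "(\<Sum>v\<in>fst p - snd p - free_exts E p. j)
      \<le> (\<Sum>v\<in>fst p - snd p - free_exts E p. card {u \<in> snd p. \<not> edge_free E (insert v (snd p - {u}))})"
    proof (rule sum_mono)
      fix v assume v: "v \<in> fst p - snd p - free_exts E p"
      let ?G = "{u \<in> snd p. edge_free E (insert v (snd p - {u}))}"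
      have "card ?G \<le> 1"
        unfolding card_le_Suc0_iff_eq[OF finite_subset[OF _ d(6)], of ?G, simplified] One_nat_def
        using blocked_at_most_one[OF d(4), of v] v by (auto simp: free_exts_def)
      moreover have "{u \<in> snd p. \<not> edge_free E (insert v (snd p - {u}))} = snd p - ?G" by auto
      moreover have "card (snd p - ?G) = Suc j - card ?G"
        using d by (subst card_Diff_subset) auto
      ultimately show "j \<le> card {u \<in> snd p. \<not> edge_free E (insert v (snd p - {u}))}" by simp
    qed
    also have "\<dots> = card (X p)" unfolding X_def using d by (subst card_SigmaI) auto
    finally show "j * (N - Suc j - card (free_exts E p)) \<le> card (X p)"
      using compl[OF p] by (simp add: mult.commute)
  qed
  ultimately show ?thesis by linarith
qed

lemma free_pairs_0: "card (free_pairs \<S> E 0) = card \<S>"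
proof -
  have "finite A" if "A \<subseteq> S" "S \<in> \<S>" for A S using that S finite_subset by blast
  moreover have "edge_free E {}" using E by (force simp: edge_free_def)
  ultimately have "free_pairs \<S> E 0 = \<S> \<times> {{}}" by (auto simp: free_pairs_def)
  then show ?thesis by (simp add: card_cartesian_product)
qed

lemma free_pairs_1: "card (free_pairs \<S> E 1) = card \<S> * N"
proof -
  have "edge_free E {a}" for a
  proof -
    have "\<not> e \<subseteq> {a}" if "e \<in> E" for e using E[OF that] card_mono[of "{a}" e] by auto
    then show ?thesis by (simp add: edge_free_def)
  qed
  then have "{A. A \<subseteq> S \<and> card A = 1 \<and> edge_free E A} = {A. A \<subseteq> S \<and> card A = 1}" for S
    by (metis (no_types, lifting) card_1_singletonE)
  then have "free_pairs \<S> E 1 = (SIGMA S:\<S>. {A. A \<subseteq> S \<and> card A = 1})"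
    unfolding free_pairs_def by simp
  moreover have "card (SIGMA S:\<S>. {A. A \<subseteq> S \<and> card A = 1})
      = (\<Sum>S\<in>\<S>. card {A. A \<subseteq> S \<and> card A = 1})"
    using fin S by (intro card_SigmaI) (auto intro: finite_subset[of _ "Pow _"])
  moreover have "(\<Sum>S\<in>\<S>. card {A. A \<subseteq> S \<and> card A = 1}) = (\<Sum>S\<in>\<S>. N)"
    using S by (intro sum.cong) (auto simp: n_subsets)
  ultimately show ?thesis by simp
qed

text \<open>A two-element set that is not edge-free is itself an edge.\<close>

lemma free_pairs_2:
  "card \<S> * (N choose 2) \<le> card (free_pairs \<S> E 2) + (\<Sum>S\<in>\<S>. card {e\<in>E. e \<subseteq> S})"
proof -
  have "card (free_pairs \<S> E 2) = (\<Sum>S\<in>\<S>. card {A. A \<subseteq> S \<and> card A = 2 \<and> edge_free E A})"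
    unfolding free_pairs_def using fin S
    by (intro card_SigmaI) (auto intro: finite_subset[of _ "Pow _"])
  moreover have "(\<Sum>S\<in>\<S>. N choose 2)
    \<le> (\<Sum>S\<in>\<S>. card {A. A \<subseteq> S \<and> card A = 2 \<and> edge_free E A} + card {e\<in>E. e \<subseteq> S})"
  proof (rule sum_mono)
    fix X assume X: "X \<in> \<S>"
    have fX: "finite X" using S[OF X] by auto
    have sub: "{A. A \<subseteq> X \<and> card A = 2} \<subseteq> {A. A \<subseteq> X \<and> card A = 2 \<and> edge_free E A} \<union> {e\<in>E. e \<subseteq> X}"
    proof clarsimp
      fix A assume A: "A \<subseteq> X" "card A = 2" "\<not> (A \<in> E)"
      have "\<not> e \<subseteq> A" if "e \<in> E" for e
      proof
        assume "e \<subseteq> A"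
        then have "e = A" using E[OF that] A(1,2) fX finite_subset by (intro card_seteq) auto
        then show False using that A by simp
      qed
      then show "edge_free E A" by (simp add: edge_free_def)
    qed
    have "N choose 2 = card {A. A \<subseteq> X \<and> card A = 2}" using S[OF X] n_subsets[of X 2] by simp
    also have "\<dots> \<le> card ({A. A \<subseteq> X \<and> card A = 2 \<and> edge_free E A} \<union> {e\<in>E. e \<subseteq> X})"
      by (rule card_mono[OF _ sub]) (rule finite_subset[of _ "Pow X"]; use fX in auto)
    also have "\<dots> \<le> card {A. A \<subseteq> X \<and> card A = 2 \<and> edge_free E A} + card {e\<in>E. e \<subseteq> X}"
      by (rule card_Un_le)
    finally show "N choose 2 \<le> card {A. A \<subseteq> X \<and> card A = 2 \<and> edge_free E A} + card {e\<in>E. e \<subseteq> X}" .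
  qed
  ultimately show ?thesis by (simp add: sum.distrib)
qed

text \<open>The double count combined with the Cauchy--Schwarz inequality. All vertex sets are treated
  at once, so that only the total number of edges matters and no convexity argument is needed.\<close>

lemma free_pairs_real_double_count:
  fixes j :: nat
  defines "n \<equiv> \<lambda>j. real (card (free_pairs \<S> E j))"
  shows "real j * ((real N - real j - 1) * n (Suc j) - real (Suc (Suc j)) * n (Suc (Suc j))) * n j
    \<le> (real (Suc j) * n (Suc j)) * ((real N - real j) * n j - real (Suc j) * n (Suc j))"
proof (cases "free_pairs \<S> E j = {}")
  case True
  then have "n j = 0" by (simp add: n_def)
  moreover have "n (Suc j) = 0" using sum_free_exts[of j] True by (simp add: n_def)
  ultimately show ?thesis by simp
next
  case False
  then have n0: "n j > 0" using finite_free_pairs by (simp add: n_def card_gt_0_iff)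
  have ext: "real (N - i - card (free_exts E p)) = real N - real i - real (card (free_exts E p))"
    if p: "p \<in> free_pairs \<S> E i" for p i
  proof -
    note d = free_pairsD[OF p]
    have "card (free_exts E p) \<le> card (fst p - snd p)"
      using d by (intro card_mono) (auto simp: free_exts_def)
    moreover have "card (fst p - snd p) = N - i" "i \<le> N" using d card_mono[of "fst p" "snd p"]
      by (auto simp: card_Diff_subset)
    ultimately show ?thesis by simp
  qed
  have sum: "(\<Sum>p\<in>free_pairs \<S> E i. real (card (free_exts E p))) = real (Suc i) * n (Suc i)" for i
    unfolding n_def using arg_cong[OF sum_free_exts[of i], of real]
    unfolding of_nat_sum of_nat_mult .
  let ?A = "real (Suc j) * n (Suc j)"
  \<comment> \<open>\<open>m\<close> is the mean number of free extensions of a free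
    \<open>j\<close>-set.\<close>
  define m where "m = ?A / n j"
  have "real (j * (\<Sum>p\<in>free_pairs \<S> E (Suc j). N - Suc j - card (free_exts E p)))
    \<le> real (\<Sum>p\<in>free_pairs \<S> E j. card (free_exts E p) * (N - j - card (free_exts E p)))"
    by (rule of_nat_mono[OF free_pairs_double_count])
  moreover have "real (j * (\<Sum>p\<in>free_pairs \<S> E (Suc j). N - Suc j - card (free_exts E p)))
    = real j * ((real N - real j - 1) * n (Suc j) - real (Suc (Suc j)) * n (Suc (Suc j)))"
  proof -
    have "(\<Sum>p\<in>free_pairs \<S> E (Suc j). real (N - Suc j - card (free_exts E p)))
      = (\<Sum>p\<in>free_pairs \<S> E (Suc j). real N - real (Suc j) - real (card (free_exts E p)))"
      by (rule sum.cong[OF refl ext])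
    also have "\<dots> = n (Suc j) * (real N - real (Suc j)) - real (Suc (Suc j)) * n (Suc (Suc j))"
      unfolding sum_subtractf sum by (simp add: n_def right_diff_distrib)
    finally show ?thesis by (simp add: mult.commute)
  qed
  moreover have "real (\<Sum>p\<in>free_pairs \<S> E j. card (free_exts E p) * (N - j - card (free_exts E p)))
    \<le> ?A * (real N - real j - m)"
  proof -
    have "real (\<Sum>p\<in>free_pairs \<S> E j. card (free_exts E p) * (N - j - card (free_exts E p)))
      = (\<Sum>p\<in>free_pairs \<S> E j. real (card (free_exts E p)) * (real N - real j - real (card (free_exts E p))))"
      unfolding of_nat_sum of_nat_mult by (rule sum.cong[OF refl]) (simp only: ext)
    \<comment> \<open>The concave function \<open>a * (N - j - a)\<close> lies below its tangent at
      \<open>m\<close>; the gap is \<open>(a - m)\<^sup>2\<close>.\<close>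
    also have "\<dots> \<le> (\<Sum>p\<in>free_pairs \<S> E j. real (card (free_exts E p)) * (real N - real j - 2 * m) + m\<^sup>2)"
    proof (rule sum_mono)
      fix p
      let ?a = "real (card (free_exts E p))"
      have "0 \<le> (?a - m)\<^sup>2" by simp
      then have "?a * (real N - real j - ?a) \<le> ?a * (real N - real j - ?a) + (?a - m)\<^sup>2" by linarith
      also have "\<dots> = ?a * (real N - real j - 2 * m) + m\<^sup>2" by (simp add: power2_eq_square algebra_simps)
      finally show "?a * (real N - real j - ?a) \<le> ?a * (real N - real j - 2 * m) + m\<^sup>2" .
    qed
    also have "\<dots> = ?A * (real N - real j - 2 * m) + n j * m\<^sup>2"
      unfolding sum.distrib sum_distrib_right[symmetric] sum by (simp add: n_def)
    also have "n j * m\<^sup>2 = ?A * m" using n0 by (simp add: m_def power2_eq_square)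
    also have "?A * (real N - real j - 2 * m) + ?A * m = ?A * (real N - real j - m)" by algebra
    finally show ?thesis .
  qed
  ultimately have "real j * ((real N - real j - 1) * n (Suc j) - real (Suc (Suc j)) * n (Suc (Suc j)))
    \<le> ?A * (real N - real j - m)" by linarith
  then have "real j * ((real N - real j - 1) * n (Suc j) - real (Suc (Suc j)) * n (Suc (Suc j))) * n j
    \<le> ?A * (real N - real j - m) * n j" using n0 by (intro mult_right_mono) auto
  also have "\<dots> = ?A * ((real N - real j) * n j - ?A)" using n0 by (simp add: m_def left_diff_distrib)
  finally show ?thesis .
qed

text \<open>\<open>d\<close> bounds the average degree over all host sets. The bound at
  \<open>j\<close> says that \<open>N - j\<close> minus the mean number of free extensions is at
  most \<open>j * d\<close>; inserted into the double count, it gives the bound at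
  \<open>j + 1\<close> after cancelling \<open>j\<close> and the number of free
  \<open>j\<close>-sets.\<close>

lemma moon_moser_step:
  fixes d :: real
  assumes d: "2 * real (\<Sum>S\<in>\<S>. card {e\<in>E. e \<subseteq> S}) \<le> d * (real (card \<S>) * real N)" and "j \<ge> 1"
  shows "(real N - real j - real j * d) * real (card (free_pairs \<S> E j))
    \<le> real (Suc j) * real (card (free_pairs \<S> E (Suc j)))"
  using \<open>j \<ge> 1\<close>
proof (induction j rule: nat_induct_at_least)
  case base
  have "real (card \<S> * (N choose 2)) \<le> real (card (free_pairs \<S> E 2) + (\<Sum>S\<in>\<S>. card {e\<in>E. e \<subseteq> S}))"
    by (rule of_nat_mono[OF free_pairs_2])
  moreover have "2 * real (N choose 2) = real N * (real N - 1)"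
  proof (cases N)
    case (Suc m)
    have "even (N * (N - 1))" by (cases "even N") auto
    then have "2 * (N choose 2) = N * (N - 1)" unfolding choose_two by (rule dvd_mult_div_cancel)
    then have "real (2 * (N choose 2)) = real (N * (N - 1))" by (rule arg_cong)
    then show ?thesis using Suc by (simp add: algebra_simps)
  qed simp
  then have "2 * (real (card \<S>) * real (N choose 2)) = real (card \<S>) * (real N * (real N - 1))"
    by (metis mult.left_commute)
  ultimately have "real (card \<S>) * (real N * (real N - 1)) - d * (real (card \<S>) * real N)
      \<le> 2 * real (card (free_pairs \<S> E 2))" using d unfolding of_nat_mult of_nat_add by linarith
  then show ?case unfolding free_pairs_1 by (simp add: algebra_simps numeral_2_eq_2)
next
  case (Suc j)
  let ?n = "\<lambda>j. real (card (free_pairs \<S> E j))"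
  show ?case
  proof (cases "?n j = 0")
    case True
    then have "free_pairs \<S> E j = {}" using finite_free_pairs by simp
    then have "?n (Suc j) = 0" using sum_free_exts[of j] by simp
    then show ?thesis by simp
  next
    case False
    then have n0: "?n j > 0" by simp
    have "real j * ((real N - real j - 1) * ?n (Suc j) - real (Suc (Suc j)) * ?n (Suc (Suc j))) * ?n j
      \<le> (real (Suc j) * ?n (Suc j)) * ((real N - real j) * ?n j - real (Suc j) * ?n (Suc j))"
      by (rule free_pairs_real_double_count)
    also have "\<dots> \<le> (real (Suc j) * ?n (Suc j)) * (real j * d * ?n j)"
    proof (rule mult_left_mono)
      show "(real N - real j) * ?n j - real (Suc j) * ?n (Suc j) \<le> real j * d * ?n j"
        using Suc.IH by (simp only: left_diff_distrib)
    qed simp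
    finally have "(real j * ?n j) * ((real N - real j - 1) * ?n (Suc j) - real (Suc (Suc j)) * ?n (Suc (Suc j)))
      \<le> (real j * ?n j) * (real (Suc j) * ?n (Suc j) * d)" by (simp only: mult_ac)
    then have "(real N - real j - 1) * ?n (Suc j) - real (Suc (Suc j)) * ?n (Suc (Suc j))
      \<le> real (Suc j) * ?n (Suc j) * d"
      using n0 Suc.hyps by (subst (asm) mult_le_cancel_left_pos) auto
    moreover have "(real N - real (Suc j) - real (Suc j) * d) * ?n (Suc j)
      = (real N - real j - 1) * ?n (Suc j) - real (Suc j) * ?n (Suc j) * d"
      by (simp add: algebra_simps)
    ultimately show ?thesis by linarith
  qed
qed

text \<open>The ratio of consecutive counts is at least \<open>1 - \<theta>\<close> times the ratio
  of the corresponding binomial coefficients, and the ratios are multiplied.\<close>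

lemma moon_moser:
  fixes d \<theta> :: real
  assumes d: "2 * real (\<Sum>S\<in>\<S>. card {e\<in>E. e \<subseteq> S}) \<le> d * (real (card \<S>) * real N)"
    and \<theta>: "\<theta> \<le> 1" "\<theta> \<ge> 0" and k: "k \<le> N" "\<And>j. j < k \<Longrightarrow> real j * d \<le> \<theta> * (real N - real j)"
  shows "real (card \<S>) * real (N choose k) * (1 - \<theta>) ^ k \<le> real (card (free_pairs \<S> E k))"
proof -
  have "j \<le> k \<Longrightarrow> real (card \<S>) * real (N choose j) * (1 - \<theta>) ^ j \<le> real (card (free_pairs \<S> E j))" for j
  proof (induction j)
    case 0
    then show ?case by (simp add: free_pairs_0)
  next
    case (Suc j)
    have jN: "j < k" "real N - real j > 0" using Suc.prems k by auto
    have step: "(1 - \<theta>) * (real N - real j) * real (card (free_pairs \<S> E j))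
      \<le> real (Suc j) * real (card (free_pairs \<S> E (Suc j)))"
    proof (cases "j = 0")
      case True
      have "(1 - \<theta>) * (real (card \<S>) * real N) \<le> 1 * (real (card \<S>) * real N)"
        using \<theta> by (intro mult_right_mono) auto
      then show ?thesis using True free_pairs_0 free_pairs_1 by (simp add: mult_ac)
    next
      case False
      have "(1 - \<theta>) * (real N - real j) \<le> real N - real j - real j * d"
        using k(2)[OF jN(1)] by (simp add: algebra_simps)
      then have "(1 - \<theta>) * (real N - real j) * real (card (free_pairs \<S> E j))
        \<le> (real N - real j - real j * d) * real (card (free_pairs \<S> E j))"
        by (intro mult_right_mono) auto
      also have "\<dots> \<le> real (Suc j) * real (card (free_pairs \<S> E (Suc j)))"
        by (rule moon_moser_step[OF d]) (use False in simp)
      finally show ?thesis .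
    qed
    have b: "real (Suc j) * real (N choose Suc j) = (real N - real j) * real (N choose j)"
      by (rule real_Suc_times_binomial_Suc) (use jN in simp)
    have "real (Suc j) * (real (card \<S>) * real (N choose Suc j) * (1 - \<theta>) ^ Suc j)
      = (real (Suc j) * real (N choose Suc j)) * (real (card \<S>) * (1 - \<theta>) ^ Suc j)"
      by (simp only: mult_ac)
    also have "\<dots> = (1 - \<theta>) * (real N - real j) * (real (card \<S>) * real (N choose j) * (1 - \<theta>) ^ j)"
      unfolding b by (simp only: power_Suc mult_ac)
    also have "\<dots> \<le> (1 - \<theta>) * (real N - real j) * real (card (free_pairs \<S> E j))"
      using Suc jN \<theta> by (intro mult_left_mono) auto
    also note step
    finally show ?case by (subst (asm) mult_le_cancel_left_pos) auto
  qed
  then show ?thesis by simp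
qed

end

subsection \<open>Counting the uncovered sets\<close>

text \<open>Compare the ratios of consecutive binomials:
  \<open>n - s - k <= (1 - s / n) * (n - k)\<close>.\<close>

lemma binomial_diff_le:
  assumes "s \<le> n" "k \<le> n" "n > 0"
  shows "real ((n - s) choose k) \<le> (1 - real s / real n) ^ k * real (n choose k)"
  using assms(2)
proof (induction k)
  case (Suc k)
  show ?case
  proof (cases "Suc k \<le> n - s")
    case False
    then have "(n - s) choose Suc k = 0" by (intro binomial_eq_0) simp
    moreover have "0 \<le> (1 - real s / real n) ^ Suc k * real (n choose Suc k)"
      using assms by (intro mult_nonneg_nonneg zero_le_power) (simp_all add: divide_simps)
    ultimately show ?thesis by (simp only: of_nat_0)
  next
    case True
    have "real s * real k \<ge> 0" by simp
    then have le: "real (n - s) - real k \<le> (1 - real s / real n) * (real n - real k)"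
      using assms by (simp add: of_nat_diff field_simps)
    have "real (Suc k) * real ((n - s) choose Suc k) = (real (n - s) - real k) * real ((n - s) choose k)"
      by (rule real_Suc_times_binomial_Suc) (use True in simp)
    also have "\<dots> \<le> ((1 - real s / real n) * (real n - real k)) * ((1 - real s / real n) ^ k * real (n choose k))"
      using Suc True le assms by (intro mult_mono le) (auto simp: divide_simps)
    also have "\<dots> = (1 - real s / real n) ^ Suc k * ((real n - real k) * real (n choose k))"
      by (simp only: power_Suc mult_ac)
    also have "(real n - real k) * real (n choose k) = real (Suc k) * real (n choose Suc k)"
      using real_Suc_times_binomial_Suc[of k n] Suc.prems by simp
    finally have "real (Suc k) * real ((n - s) choose Suc k)
      \<le> real (Suc k) * ((1 - real s / real n) ^ Suc k * real (n choose Suc k))"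
      by (simp only: mult_ac)
    then show ?thesis by (subst (asm) mult_le_cancel_left_pos) auto
  qed
qed simp

text \<open>\<open>\<rho>\<close> is the proportion of bad \<open>N\<close>-sets per family.
  Hypothesis \<open>main\<close> lets the edges cost only a factor
  \<open>1 - \<gamma> * s / n\<close> per element of a \<open>k\<close>-set, against the permitted
  \<open>1 - s / n\<close>; the slack \<open>1 - \<gamma>\<close> pays for the bad sets.\<close>

lemma uncovered_count:
  fixes V :: "'a set" and F E B :: "'i \<Rightarrow> 'a set set" and \<gamma> \<rho> :: real
  assumes V: "finite V" and I: "finite I" "I \<noteq> {}" "card I < card V"
    and k: "k \<ge> 1" "k < N" "N \<le> card V"
    and E: "\<And>i. i \<in> I \<Longrightarrow> E i \<subseteq> ksubsets V 2 \<and> card (E i) \<le> m"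
    and B: "\<And>i. i \<in> I \<Longrightarrow> B i \<subseteq> ksubsets V N \<and> real (card (B i)) \<le> \<rho> * real (card V choose N)"
    and EB: "\<And>i K S. i \<in> I \<Longrightarrow> K \<in> F i \<Longrightarrow> K \<subseteq> S \<Longrightarrow> S \<in> ksubsets V N - B i \<Longrightarrow> \<exists>e\<in>E i. e \<subseteq> K"
    and \<rho>: "\<rho> \<ge> 0" "real (card V) * \<rho> < 1 - \<gamma>" and \<gamma>: "0 < \<gamma>" "\<gamma> < 1"
    and main: "2 * real k * real m * real N \<le> \<gamma> * real (card V) * (1 - real (card V) * \<rho>) * (real N - real k)"
  shows "(card V - card I) choose k < card (ksubsets V k - (\<Union>i\<in>I. F i))"
proof -
  define n where "n = real (card V)"
  define s where "s = real (card I)"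
  define c where "c = real (card V choose N)"
  define EE where "EE = (\<Union>i\<in>I. E i)"
  define \<S> where "\<S> = ksubsets V N - (\<Union>i\<in>I. B i)"
  define Good where "Good = ksubsets V k - (\<Union>i\<in>I. F i)"
  \<comment> \<open>There are at most \<open>s * m\<close> edges, each in at most a proportion
    \<open>(N / n)\<^sup>2\<close> of the \<open>N\<close>-sets, which have \<open>N\<close>
    vertices each; \<open>1 - n * \<rho>\<close> accounts for the discarded
    \<open>N\<close>-sets.\<close>
  define d where "d = 2 * s * real m * real N / (n\<^sup>2 * (1 - n * \<rho>))"
  define \<theta> where "\<theta> = \<gamma> * s / n"
  note main = main[folded n_def] and \<rho> = \<rho>[folded n_def]
  have s0: "s > 0" "s < n" using I by (auto simp: s_def n_def card_gt_0_iff)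
  have n0: "n > 0" using s0 by simp
  have c0: "c > 0" using k by (simp add: c_def)
  have P: "0 < 1 - n * \<rho>" using \<rho> \<gamma> by linarith
  have "s * \<rho> \<le> n * \<rho>" using s0 \<rho> by (intro mult_right_mono) auto
  then have sP: "1 - n * \<rho> \<le> 1 - s * \<rho>" by simp

  have fin\<S>: "finite \<S>" using V by (simp add: \<S>_def)
  have S: "finite S \<and> card S = N" if "S \<in> \<S>" for S using that V finite_subset by (auto simp: \<S>_def)
  have EE: "card e = 2" "e \<subseteq> V" if "e \<in> EE" for e using that E by (auto simp: EE_def)
  have finEE: "finite EE" using EE(2) V by (intro finite_subset[of EE "Pow V"]) auto
  have "card EE \<le> (\<Sum>i\<in>I. card (E i))" unfolding EE_def by (rule card_UN_le[OF I(1)])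
  also have "\<dots> \<le> (\<Sum>i\<in>I. m)" using E by (intro sum_mono) auto
  finally have cEE: "real (card EE) \<le> s * real m" by (simp add: s_def flip: of_nat_mult)

  have "card (\<Union>i\<in>I. B i) \<le> (\<Sum>i\<in>I. card (B i))" by (rule card_UN_le[OF I(1)])
  then have "real (card (\<Union>i\<in>I. B i)) \<le> real (\<Sum>i\<in>I. card (B i))" by (rule of_nat_mono)
  also have "\<dots> = (\<Sum>i\<in>I. real (card (B i)))" by simp
  also have "\<dots> \<le> (\<Sum>i\<in>I. \<rho> * c)" using B by (intro sum_mono) (auto simp: c_def)
  also have "\<dots> = s * \<rho> * c" by (simp add: s_def)
  finally have "real (card (\<Union>i\<in>I. B i)) \<le> s * \<rho> * c" .
  moreover have "real (card (ksubsets V N)) - real (card (\<Union>i\<in>I. B i)) \<le> real (card \<S>)"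
    unfolding \<S>_def using diff_card_le_card_Diff[of "\<Union>i\<in>I. B i" "ksubsets V N"] B V
      finite_subset[of "\<Union>i\<in>I. B i" "ksubsets V N"] by (auto simp: SUP_le_iff)
  ultimately have card\<S>: "(1 - s * \<rho>) * c \<le> real (card \<S>)"
    using card_ksubsets[OF V, of N] by (simp add: c_def algebra_simps)
  have "(1 - n * \<rho>) * c \<le> (1 - s * \<rho>) * c" using sP c0 by (intro mult_right_mono) auto
  then have card\<S>': "(1 - n * \<rho>) * c \<le> real (card \<S>)" using card\<S> by linarith

  have edges: "2 * real (\<Sum>S\<in>\<S>. card {e\<in>EE. e \<subseteq> S}) \<le> d * (real (card \<S>) * real N)"
  proof -
    have "(\<Sum>S\<in>\<S>. card {e\<in>EE. e \<subseteq> S}) \<le> (\<Sum>S\<in>ksubsets V N. card {e\<in>EE. e \<subseteq> S})"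
      by (rule sum_mono2) (use V in \<open>auto simp: \<S>_def\<close>)
    also have "\<dots> = (\<Sum>e\<in>EE. card {S\<in>ksubsets V N. e \<subseteq> S})"
      using sum_multicount_gen[of "ksubsets V N" EE "\<lambda>S e. e \<subseteq> S" "\<lambda>e. card {S\<in>ksubsets V N. e \<subseteq> S}"] finEE V
      by simp
    finally have "real (\<Sum>S\<in>\<S>. card {e\<in>EE. e \<subseteq> S}) \<le> real (\<Sum>e\<in>EE. card {S\<in>ksubsets V N. e \<subseteq> S})"
      by (rule of_nat_mono)
    also have "\<dots> = (\<Sum>e\<in>EE. real (card {S\<in>ksubsets V N. e \<subseteq> S}))" by simp
    also have "\<dots> \<le> (\<Sum>e\<in>EE. (real N / n) ^ 2 * c)"
    proof (rule sum_mono)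
      fix e assume "e \<in> EE"
      then show "real (card {S\<in>ksubsets V N. e \<subseteq> S}) \<le> (real N / n) ^ 2 * c"
        using card_supersets_le[OF V _ k(3), of e] EE by (simp add: n_def c_def)
    qed
    also have "\<dots> = real (card EE) * ((real N / n) ^ 2 * c)" by (rule sum_constant)
    also have "\<dots> \<le> (s * real m) * ((real N / n) ^ 2 * c)"
      using c0 by (intro mult_right_mono cEE) auto
    finally have 1: "2 * real (\<Sum>S\<in>\<S>. card {e\<in>EE. e \<subseteq> S}) \<le> 2 * (s * real m * ((real N / n) ^ 2 * c))"
      by simp
    have d0: "d \<ge> 0" using s0 P by (simp add: d_def)
    have "2 * (s * real m * ((real N / n) ^ 2 * c)) = d * (((1 - n * \<rho>) * c) * real N)"
      using P n0 by (simp add: d_def field_simps power2_eq_square)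
    also have "\<dots> \<le> d * (real (card \<S>) * real N)"
      using d0 card\<S>' by (intro mult_left_mono mult_right_mono) auto
    finally show ?thesis using 1 by linarith
  qed

  have \<theta>: "0 \<le> \<theta>" "\<theta> < 1"
  proof -
    have "\<gamma> * s < 1 * n" using s0 \<gamma> by (intro mult_strict_mono) auto
    then show "0 \<le> \<theta>" "\<theta> < 1" using s0 \<gamma> n0 by (auto simp: \<theta>_def)
  qed
  have jd: "real j * d \<le> \<theta> * (real N - real j)" if "j < k" for j
  proof -
    have d0: "d \<ge> 0" using s0 P by (simp add: d_def)
    have "real j * d \<le> real k * d" using that d0 by (intro mult_right_mono) auto
    also have "\<dots> = (2 * real k * real m * real N) * (s / (n\<^sup>2 * (1 - n * \<rho>)))" by (simp add: d_def)
    also have "\<dots> \<le> (\<gamma> * n * (1 - n * \<rho>) * (real N - real k)) * (s / (n\<^sup>2 * (1 - n * \<rho>)))"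
      using main P s0 by (intro mult_right_mono) auto
    also have "\<dots> = \<theta> * (real N - real k)" using P n0 by (simp add: \<theta>_def power2_eq_square)
    also have "\<dots> \<le> \<theta> * (real N - real j)" using that \<theta> by (intro mult_left_mono) auto
    finally show ?thesis .
  qed
  have "real (card \<S>) * real (N choose k) * (1 - \<theta>) ^ k \<le> real (card (free_pairs \<S> EE k))"
    by (rule moon_moser[OF fin\<S> S EE(1) edges _ \<theta>(1) _ jd]) (use \<theta> k in auto)
  \<comment> \<open>An edge-free \<open>k\<close>-set inside an \<open>N\<close>-set that is bad for
    no family belongs to no family. Each such set is counted at most
    \<open>(n - k) choose (N - k)\<close> times.\<close>
  moreover have "card (free_pairs \<S> EE k) \<le> card (SIGMA A:Good. {S \<in> ksubsets V N. A \<subseteq> S})"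
  proof (rule card_inj_on_le)
    show "inj_on (\<lambda>(S, A). (A, S)) (free_pairs \<S> EE k)" by (auto simp: inj_on_def)
    show "finite (SIGMA A:Good. {S \<in> ksubsets V N. A \<subseteq> S})" using V by (simp add: Good_def)
    show "(\<lambda>(S, A). (A, S)) ` free_pairs \<S> EE k \<subseteq> (SIGMA A:Good. {S \<in> ksubsets V N. A \<subseteq> S})"
    proof clarsimp
      fix S A assume "(S, A) \<in> free_pairs \<S> EE k"
      then have A: "S \<in> \<S>" "A \<subseteq> S" "card A = k" "edge_free EE A" by (auto simp: free_pairs_def)
      have "A \<notin> F i" if i: "i \<in> I" for i
      proof
        assume "A \<in> F i"
        moreover have "S \<in> ksubsets V N - B i" using A(1) i by (auto simp: \<S>_def)
        ultimately obtain e where "e \<in> E i" "e \<subseteq> A" using EB[OF i _ A(2)] by blast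
        then show False using A(4) i unfolding edge_free_def EE_def by blast
      qed
      then show "A \<in> Good \<and> S \<subseteq> V \<and> card S = N \<and> A \<subseteq> S" using A by (auto simp: Good_def \<S>_def)
    qed
  qed
  moreover have "card (SIGMA A:Good. {S \<in> ksubsets V N. A \<subseteq> S}) = card Good * ((card V - k) choose (N - k))"
  proof -
    have "card (SIGMA A:Good. {S \<in> ksubsets V N. A \<subseteq> S}) = (\<Sum>A\<in>Good. card {S \<in> ksubsets V N. A \<subseteq> S})"
      using V by (intro card_SigmaI) (auto simp: Good_def)
    also have "\<dots> = (\<Sum>A\<in>Good. (card V - k) choose (N - k))"
    proof (rule sum.cong[OF refl])
      fix A assume "A \<in> Good"
      then have "A \<subseteq> V" "card A = k" by (auto simp: Good_def)
      then show "card {S \<in> ksubsets V N. A \<subseteq> S} = (card V - k) choose (N - k)"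
        using card_supersets_eq[OF V, of A N] k by simp
    qed
    finally show ?thesis by simp
  qed
  ultimately have "real (card \<S>) * real (N choose k) * (1 - \<theta>) ^ k
    \<le> real (card Good * ((card V - k) choose (N - k)))"
    by (metis (no_types, lifting) of_nat_mono order_trans)
  moreover have "((1 - s * \<rho>) * c) * (real (N choose k) * (1 - \<theta>) ^ k)
    \<le> real (card \<S>) * (real (N choose k) * (1 - \<theta>) ^ k)"
    using card\<S> \<theta> by (intro mult_right_mono) auto
  moreover have cc: "c * real (N choose k) = real (card V choose k) * real ((card V - k) choose (N - k))"
    using choose_mult[of k N "card V"] k unfolding c_def by (metis less_imp_le of_nat_mult)
  moreover have "((1 - s * \<rho>) * (1 - \<theta>) ^ k * real (card V choose k)) * real ((card V - k) choose (N - k))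
    = ((1 - s * \<rho>) * c) * (real (N choose k) * (1 - \<theta>) ^ k)"
    using arg_cong[OF cc, of "\<lambda>x. (1 - s * \<rho>) * (1 - \<theta>) ^ k * x"] by (simp only: mult_ac)
  ultimately have "((1 - s * \<rho>) * (1 - \<theta>) ^ k * real (card V choose k)) * real ((card V - k) choose (N - k))
    \<le> real (card Good) * real ((card V - k) choose (N - k))"
    unfolding of_nat_mult mult.assoc[of "real (card \<S>)"] by linarith
  then have good: "(1 - s * \<rho>) * (1 - \<theta>) ^ k * real (card V choose k) \<le> real (card Good)"
    by (rule mult_right_le_imp_le) (use k in simp)

  define t where "t = s / n"
  have t: "0 < t" "t < 1" using s0 by (auto simp: t_def)
  have gt: "\<theta> = \<gamma> * t" by (simp add: \<theta>_def t_def)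
  let ?u = "1 - (1 - \<gamma>) * t"
  have "(1 - \<gamma>) * t \<le> 1 * 1" using t \<gamma> by (intro mult_mono) auto
  then have u: "0 \<le> ?u" "?u \<le> 1" using t \<gamma> by auto
  have "real ((card V - card I) choose k) \<le> (1 - t) ^ k * real (card V choose k)"
    using binomial_diff_le[of "card I" "card V" k] I k unfolding t_def s_def n_def by simp
  also have "\<dots> \<le> ((1 - \<theta>) * ?u) ^ k * real (card V choose k)"
  proof (intro mult_right_mono power_mono)
    \<comment> \<open>The product \<open>(1 - \<gamma> * t) * (1 - (1 - \<gamma>) * t)\<close>
      exceeds \<open>1 - t\<close> by exactly this quantity.\<close>
    have "\<gamma> * (1 - \<gamma>) * t\<^sup>2 \<ge> 0" using \<gamma> by simp
    then show "1 - t \<le> (1 - \<theta>) * ?u" unfolding gt by (simp add: algebra_simps power2_eq_square)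
  qed (use t in auto)
  also have "\<dots> = ?u ^ k * ((1 - \<theta>) ^ k * real (card V choose k))" by (simp add: power_mult_distrib)
  \<comment> \<open>One of the \<open>k\<close> factors \<open>?u\<close> suffices: it lies below
    \<open>1 - s * \<rho>\<close> because \<open>n * \<rho> < 1 - \<gamma>\<close>.\<close>
  also have "\<dots> \<le> ?u * ((1 - \<theta>) ^ k * real (card V choose k))"
    using u k \<theta> power_decreasing[of 1 k ?u] by (intro mult_right_mono) auto
  also have "\<dots> < (1 - s * \<rho>) * ((1 - \<theta>) ^ k * real (card V choose k))"
  proof (rule mult_strict_right_mono)
    have "s * (n * \<rho>) < s * (1 - \<gamma>)" using s0 \<rho> by (intro mult_strict_left_mono) auto
    then show "?u < 1 - s * \<rho>" using n0 by (simp add: t_def field_simps)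
    show "0 < (1 - \<theta>) ^ k * real (card V choose k)" using \<theta> k by simp
  qed
  also have "\<dots> \<le> real (card Good)" using good by (simp add: mult_ac)
  finally show ?thesis by (simp add: Good_def)
qed

section \<open>Asymptotics of the parameters\<close>

text \<open>With \<open>h = n ^ (-1/4)\<close> all error terms are polynomials in \<open>h\<close>
  that vanish at 0. At \<open>h = 0\<close> the required inequalities hold strictly, so they persist
  for small \<open>h\<close>.\<close>

lemma eventually_parameters:
  fixes a \<gamma> :: real and M :: nat
  assumes a: "a * real M < \<gamma> * (real M - 1)" and \<gamma>: "\<gamma> < 1"
  shows "eventually (\<lambda>n::nat. \<exists>h>0. real n * h ^ 4 = 1 \<and>
    (a + 512 * h\<^sup>2) * real M \<le> \<gamma> * (1 - (256 * real M ^ 3 * h\<^sup>2 + (80 * real M) ^ 5 * h)) * (real M - 1) \<and>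
    256 * real M ^ 3 * h\<^sup>2 + (80 * real M) ^ 5 * h < 1 - \<gamma> \<and>
    80 * real M * h \<le> 1 \<and> real M * h\<^sup>2 \<le> 1) sequentially"
proof -
  \<comment> \<open>since \<open>k\<^sup>2 \<le> n\<close>, this makes \<open>N / n = O(h\<^sup>2)\<close> and \<open>r N / n = O(h)\<close>\<close>
  define h where "h n = real n powr (- 1 / 4)" for n
  have h0: "h \<longlonglongrightarrow> 0" unfolding h_def
    by (rule tendsto_neg_powr) (auto intro: filterlim_real_sequentially)
  let ?\<rho> = "\<lambda>x. 256 * real M ^ 3 * x\<^sup>2 + (80 * real M) ^ 5 * x"
  have \<rho>: "(\<lambda>n. ?\<rho> (h n)) \<longlonglongrightarrow> 256 * real M ^ 3 * 0\<^sup>2 + (80 * real M) ^ 5 * 0"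
    by (intro tendsto_intros h0)
  have "(\<lambda>n. \<gamma> * (1 - ?\<rho> (h n)) * (real M - 1) - (a + 512 * (h n)\<^sup>2) * real M)
    \<longlonglongrightarrow> \<gamma> * (1 - (256 * real M ^ 3 * 0\<^sup>2 + (80 * real M) ^ 5 * 0)) * (real M - 1) - (a + 512 * 0\<^sup>2) * real M"
    by (intro tendsto_intros h0 \<rho>)
  then have e1: "eventually (\<lambda>n. 0 < \<gamma> * (1 - ?\<rho> (h n)) * (real M - 1) - (a + 512 * (h n)\<^sup>2) * real M) sequentially"
    by (rule order_tendstoD) (use a in simp)
  have e2: "eventually (\<lambda>n. ?\<rho> (h n) < 1 - \<gamma>) sequentially"
    using \<rho> by (rule order_tendstoD) (use \<gamma> in simp)
  have "(\<lambda>n. 80 * real M * h n) \<longlonglongrightarrow> 80 * real M * 0" by (intro tendsto_intros h0)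
  then have e3: "eventually (\<lambda>n. 80 * real M * h n < 1) sequentially"
    by (rule order_tendstoD) simp
  have "(\<lambda>n. real M * (h n)\<^sup>2) \<longlonglongrightarrow> real M * 0\<^sup>2" by (intro tendsto_intros h0)
  then have e4: "eventually (\<lambda>n. real M * (h n)\<^sup>2 < 1) sequentially"
    by (rule order_tendstoD) simp
  have e5: "eventually (\<lambda>n::nat. n > 0) sequentially" by (rule eventually_gt_at_top)
  show ?thesis
    using e1 e2 e3 e4 e5
  proof eventually_elim
    case (elim n)
    have "h n ^ 4 = real n powr - 1" using elim by (simp add: h_def powr_power)
    then have "real n * h n ^ 4 = 1" using elim by (simp add: powr_minus)
    moreover have "h n > 0" using elim by (simp add: h_def)
    ultimately show ?case using elim by (intro exI[of _ "h n"]) auto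
  qed
qed

section \<open>Fixing the constants and combining the estimates\<close>

theorem theorem1:
  fixes \<epsilon> :: real
  assumes "\<epsilon> > 0"
  shows "\<exists>n0::nat. \<forall>(n::nat) (k::nat) (s::nat) (F :: nat \<Rightarrow> nat set set).
    n \<ge> n0 \<longrightarrow> real n > (2 + \<epsilon>) * (real k)\<^sup>2 \<longrightarrow> 0 < s \<longrightarrow> s < n \<longrightarrow>
    (\<forall>i\<in>{1..s}. F i \<subseteq> uniform_subsets n k \<and> nontrivial_intersecting (F i)) \<longrightarrow>
    card (\<Union>i\<in>{1..s}. F i) < (n choose k) - ((n - s) choose k)"
proof -
  \<comment> \<open>The hypothesis on \<open>n\<close> becomes \<open>2 * k\<^sup>2 <= a * n\<close>
    with \<open>a < 1\<close>, and \<open>\<gamma>\<close> is the midpoint between \<open>a\<close>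
    and 1.\<close>
  define a where "a = 2 / (2 + \<epsilon>)"
  define \<gamma> where "\<gamma> = (1 + a) / 2"
  have a: "0 < a" "a < 1" using assms by (auto simp: a_def)
  have \<gamma>: "0 < \<gamma>" "\<gamma> < 1" "a < \<gamma>" using a by (auto simp: \<gamma>_def)
  \<comment> \<open>\<open>M > \<gamma> / (\<gamma> - a)\<close> is
    \<open>a * M < \<gamma> * (M - 1)\<close>; the \<open>- 1\<close> stems from
    \<open>N - k = (M - 1) * k\<close>.\<close>
  obtain M :: nat where M0: "real M > max 2 (\<gamma> / (\<gamma> - a))" using reals_Archimedean2 by blast
  then have M: "real M \<ge> 2" and "\<gamma> < real M * (\<gamma> - a)" using \<gamma> by (auto simp: divide_simps)
  then have aM: "a * real M < \<gamma> * (real M - 1)" by (simp add: algebra_simps)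
  obtain n0 where n0: "\<And>n. n \<ge> n0 \<Longrightarrow> \<exists>h>0. real n * h ^ 4 = 1 \<and>
    (a + 512 * h\<^sup>2) * real M \<le> \<gamma> * (1 - (256 * real M ^ 3 * h\<^sup>2 + (80 * real M) ^ 5 * h)) * (real M - 1) \<and>
    256 * real M ^ 3 * h\<^sup>2 + (80 * real M) ^ 5 * h < 1 - \<gamma> \<and>
    80 * real M * h \<le> 1 \<and> real M * h\<^sup>2 \<le> 1"
    using eventually_parameters[OF aM \<gamma>(2)] unfolding eventually_sequentially by blast
  show ?thesis
  proof (intro exI[of _ n0] allI impI)
    fix n k s :: nat and F :: "nat \<Rightarrow> nat set set"
    assume n: "n \<ge> n0" and nk: "(2 + \<epsilon>) * (real k)\<^sup>2 < real n" and s: "0 < s" "s < n"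
      and "\<forall>i\<in>{1..s}. F i \<subseteq> uniform_subsets n k \<and> nontrivial_intersecting (F i)"
    then have F: "F i \<subseteq> ksubsets {1..n} k" "nontrivial_intersecting (F i)" if "i \<in> {1..s}" for i
      using that by (auto simp: uniform_subsets_def)
    obtain h where h: "h > 0" "real n * h ^ 4 = 1"
      and main: "(a + 512 * h\<^sup>2) * real M
        \<le> \<gamma> * (1 - (256 * real M ^ 3 * h\<^sup>2 + (80 * real M) ^ 5 * h)) * (real M - 1)"
      and small: "256 * real M ^ 3 * h\<^sup>2 + (80 * real M) ^ 5 * h < 1 - \<gamma>"
        "80 * real M * h \<le> 1" "real M * h\<^sup>2 \<le> 1"
      using n0[OF n] by blast
    have k1: "k \<ge> 1"
    proof (rule ccontr)
      assume "\<not> k \<ge> 1"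
      have 1: "(1::nat) \<in> {1..s}" using s by simp
      obtain A where A: "A \<in> F 1" "1 \<notin> A" using nontrivial_not_covered[OF F(2)[OF 1]] .
      then have "A \<subseteq> {1..n}" "card A = 0" using F(1)[OF 1] \<open>\<not> k \<ge> 1\<close> by auto
      then have "A = {}" using finite_subset[of A "{1..n}"] by simp
      then show False using A(1) F(2)[OF 1] by (auto simp: nontrivial_intersecting_def intersecting_def)
    qed
    define N where "N = M * k"
    \<comment> \<open>\<open>80\<^sup>2 = 6400\<close> exceeds 6144.\<close>
    define r where "r = 80 * sqrt (real k)"
    define p where "p = real N / real n"
    define \<rho> where "\<rho> = 256 * p ^ 3 + (r * real N / real n) ^ 5"
    have n_pos: "real n > 0" using s by simp
    have h4: "h ^ 4 = 1 / real n" using h n_pos by (simp add: field_simps)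
    have ak: "2 * (real k)\<^sup>2 \<le> a * real n" using nk assms by (simp add: a_def field_simps)
    have kn: "(real k)\<^sup>2 \<le> real n"
    proof -
      have "2 * (real k)\<^sup>2 \<le> 2 * real n" using ak a n_pos mult_right_mono[of a 1 "real n"] by linarith
      then show ?thesis by simp
    qed
    have kh: "real k * h\<^sup>2 \<le> 1"
    proof -
      have "(real k * h\<^sup>2)\<^sup>2 = (real k)\<^sup>2 * h ^ 4" by (simp add: power_mult_distrib flip: power_mult)
      also have "\<dots> \<le> real n * h ^ 4" using kn by (intro mult_right_mono) auto
      finally have "(real k * h\<^sup>2)\<^sup>2 \<le> 1\<^sup>2" using h by simp
      then show ?thesis by (rule power2_le_imp_le) simp
    qed
    have pM: "p = (real k * h\<^sup>2) * (real M * h\<^sup>2)"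
    proof -
      have "p = real M * real k * h ^ 4" by (simp add: p_def N_def h4)
      then show ?thesis by (simp add: power4_eq_xxxx power2_eq_square)
    qed
    have p: "0 \<le> p" "p \<le> real M * h\<^sup>2"
    proof -
      show "0 \<le> p" by (simp add: p_def)
      have "p \<le> 1 * (real M * h\<^sup>2)" unfolding pM by (intro mult_right_mono kh) auto
      then show "p \<le> real M * h\<^sup>2" by simp
    qed
    have sk: "sqrt (real k) * h \<le> 1"
    proof -
      have "(sqrt (real k) * h)\<^sup>2 \<le> 1\<^sup>2" using kh by (simp add: power_mult_distrib)
      then show ?thesis by (rule power2_le_imp_le) simp
    qed
    have rp: "0 \<le> r * real N / real n" "r * real N / real n \<le> 80 * real M * h"
    proof -
      show "0 \<le> r * real N / real n" by (simp add: r_def)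
      have "r * real N / real n = r * p" by (simp add: p_def)
      also have "\<dots> = (sqrt (real k) * h) * ((real k * h\<^sup>2) * (80 * real M * h))"
        unfolding pM r_def by (simp add: power2_eq_square)
      also have "\<dots> \<le> 1 * (1 * (80 * real M * h))"
        using sk kh h by (intro mult_mono) auto
      finally show "r * real N / real n \<le> 80 * real M * h" by simp
    qed
    \<comment> \<open>One factor \<open>h ^ 4\<close> of \<open>h ^ 6\<close> and of
      \<open>h ^ 5\<close> cancels \<open>n\<close>, leaving terms that tend to 0.\<close>
    have \<rho>: "0 \<le> \<rho>" "real n * \<rho> \<le> 256 * real M ^ 3 * h\<^sup>2 + (80 * real M) ^ 5 * h"
    proof -
      show "0 \<le> \<rho>" using p(1) rp(1) by (simp add: \<rho>_def)
      have "\<rho> \<le> 256 * (real M * h\<^sup>2) ^ 3 + (80 * real M * h) ^ 5"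
        unfolding \<rho>_def using p rp by (intro add_mono mult_left_mono power_mono) auto
      then have "real n * \<rho> \<le> real n * (256 * (real M * h\<^sup>2) ^ 3 + (80 * real M * h) ^ 5)"
        using n_pos by (intro mult_left_mono) auto
      also have "\<dots> = (real n * h ^ 4) * (256 * real M ^ 3 * h\<^sup>2 + (80 * real M) ^ 5 * h)"
        by (simp add: power_mult_distrib distrib_left eval_nat_numeral)
      finally show "real n * \<rho> \<le> 256 * real M ^ 3 * h\<^sup>2 + (80 * real M) ^ 5 * h" using h by simp
    qed
    have kN: "k < N" using M k1 by (simp add: N_def)
    have Nn: "N \<le> n"
    proof -
      have "p \<le> 1" using p small by linarith
      then show ?thesis using n_pos by (simp add: p_def)
    qed
    have r: "r \<ge> 8" "r\<^sup>2 \<ge> 6144 * real k" "r * real N / real (card {1..n}) \<le> 1"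
    proof -
      have "1 \<le> sqrt (real k)" using k1 by simp
      then show "r \<ge> 8" unfolding r_def by linarith
      show "r\<^sup>2 \<ge> 6144 * real k" by (simp add: r_def power_mult_distrib)
      show "r * real N / real (card {1..n}) \<le> 1" using rp small by simp
    qed
    define Q where "Q i E B \<longleftrightarrow> E \<subseteq> ksubsets {1..n} 2 \<and> card E \<le> k + 256 \<and> B \<subseteq> ksubsets {1..n} N \<and>
        real (card B) \<le> \<rho> * real (n choose N) \<and>
        (\<forall>K S. K \<in> F i \<longrightarrow> K \<subseteq> S \<longrightarrow> S \<in> ksubsets {1..n} N - B \<longrightarrow> (\<exists>e\<in>E. e \<subseteq> K))" for i E B
    have "\<exists>E B. Q i E B"
      if i: "i \<in> {1..s}" for i
    proof -
      have Nc: "N \<le> card {1..n}" using Nn by simp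
      obtain E B where "E \<subseteq> ksubsets {1..n} 2" "card E \<le> k + 256" "B \<subseteq> ksubsets {1..n} N"
        "real (card B) \<le> (256 * (real N / real (card {1..n})) ^ 3 + (r * real N / real (card {1..n})) ^ 5)
          * real (card {1..n} choose N)"
        "\<And>K S. K \<in> F i \<Longrightarrow> K \<subseteq> S \<Longrightarrow> S \<in> ksubsets {1..n} N - B \<Longrightarrow> \<exists>e\<in>E. e \<subseteq> K"
        by (rule nontrivial_intersecting_structure[OF finite_atLeastAtMost F[OF i] Nc r]) blast
      then show ?thesis unfolding Q_def \<rho>_def p_def
        by (intro exI[of _ E] exI[of _ B] conjI allI impI) simp_all
    qed
    then obtain E B where Q: "\<And>i. i \<in> {1..s} \<Longrightarrow> Q i (E i) (B i)" by metis
    note EB = Q[unfolded Q_def]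
    have main': "2 * real k * real (k + 256) * real N
        \<le> \<gamma> * real n * (1 - real n * \<rho>) * (real N - real k)"
    proof -
      \<comment> \<open>\<open>n * h\<^sup>2\<close> is \<open>sqrt n\<close>, so the contribution
        \<open>512 * k\<close> of the 256 extra edges is of lower order than
        \<open>n\<close>.\<close>
      have kh2: "real k \<le> real n * h\<^sup>2"
      proof -
        have "(real n * h\<^sup>2) * 1 \<ge> (real n * h\<^sup>2) * (real k * h\<^sup>2)"
          using n_pos kh by (intro mult_left_mono) auto
        moreover have "(real n * h\<^sup>2) * (real k * h\<^sup>2) = real k * (real n * h ^ 4)"
          by (simp add: power4_eq_xxxx power2_eq_square)
        ultimately show ?thesis using h by simp
      qed
      have "2 * real k * real (k + 256) = 2 * (real k)\<^sup>2 + 512 * real k"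
        by (simp add: power2_eq_square algebra_simps)
      also have "\<dots> \<le> a * real n + 512 * (real n * h\<^sup>2)"
        using ak kh2 by (intro add_mono mult_left_mono) auto
      also have "\<dots> = real n * (a + 512 * h\<^sup>2)" by (simp add: algebra_simps)
      finally have "(2 * real k * real (k + 256)) * (real M * real k)
        \<le> (real n * (a + 512 * h\<^sup>2)) * (real M * real k)" by (intro mult_right_mono) auto
      also have "\<dots> = (real n * real k) * ((a + 512 * h\<^sup>2) * real M)" by (simp only: mult_ac)
      also have "\<dots> \<le> (real n * real k) * (\<gamma> * (1 - real n * \<rho>) * (real M - 1))"
      proof (rule mult_left_mono)
        have "\<gamma> * (1 - (256 * real M ^ 3 * h\<^sup>2 + (80 * real M) ^ 5 * h)) * (real M - 1)
          \<le> \<gamma> * (1 - real n * \<rho>) * (real M - 1)"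
          using \<rho>(2) \<gamma> M by (intro mult_right_mono mult_left_mono) auto
        then show "(a + 512 * h\<^sup>2) * real M \<le> \<gamma> * (1 - real n * \<rho>) * (real M - 1)" using main by linarith
      qed simp
      also have "\<dots> = \<gamma> * real n * (1 - real n * \<rho>) * (real N - real k)"
        unfolding N_def of_nat_mult by (simp add: algebra_simps)
      finally show ?thesis by (simp add: N_def mult_ac)
    qed
    have "(card {1..n} - card {1..s}) choose k < card (ksubsets {1..n} k - (\<Union>i\<in>{1..s}. F i))"
    proof (rule uncovered_count[where N = N and E = E and B = B and m = "k + 256" and \<gamma> = \<gamma> and \<rho> = \<rho>])
      show "real (card {1..n}) * \<rho> < 1 - \<gamma>" using \<rho>(2) small(1) by simp
      show "2 * real k * real (k + 256) * real N
        \<le> \<gamma> * real (card {1..n}) * (1 - real (card {1..n}) * \<rho>) * (real N - real k)"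
        using main' by simp
    next
      fix i K S assume "i \<in> {1..s}" "K \<in> F i" "K \<subseteq> S" "S \<in> ksubsets {1..n} N - B i"
      then show "\<exists>e\<in>E i. e \<subseteq> K" using EB by blast
    next
      fix i assume "i \<in> {1..s}"
      then show "E i \<subseteq> ksubsets {1..n} 2 \<and> card (E i) \<le> k + 256"
        "B i \<subseteq> ksubsets {1..n} N \<and> real (card (B i)) \<le> \<rho> * real (card {1..n} choose N)"
        using EB by simp_all
    qed (use s k1 kN Nn \<rho> \<gamma> in simp_all)
    moreover have "(\<Union>i\<in>{1..s}. F i) \<subseteq> ksubsets {1..n} k" using F(1) by blast
    then have "card (ksubsets {1..n} k - (\<Union>i\<in>{1..s}. F i)) + card (\<Union>i\<in>{1..s}. F i) = n choose k"
      using card_Diff_subset[of "\<Union>i\<in>{1..s}. F i" "ksubsets {1..n} k"] card_mono[of "ksubsets {1..n} k" "\<Union>i\<in>{1..s}. F i"]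
        card_ksubsets[of "{1..n}" k] finite_subset[of "\<Union>i\<in>{1..s}. F i" "ksubsets {1..n} k"] by simp
    \<comment> \<open>The uncovered sets outnumber \<open>(n - s) choose k\<close>, so the
      subtraction of natural numbers is not truncated.\<close>
    ultimately show "card (\<Union>i\<in>{1..s}. F i) < (n choose k) - ((n - s) choose k)" by simp
  qed
qed

end
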